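(* Let $p\in(1,\infty]$ and $f\in H^{p}$. If $$\sum_{n=2}^\infty \frac{R_{n}(f,H^{p})}{n \sqrt{\log n}}<\infty,$$ then $f'\in A^{1}(\mathbb{D})$.
   Context: $\mathbb{D}$ is the open unit disc in $\mathbb{C}$; $H^p$ is the standard Hardy space in $\mathbb{D}$ with norm $\|\cdot\|_{H^p}$; $A^1(\mathbb{D})$ is the usual (unweighted) Bergman space of functions analytic in $\mathbb{D}$ and integrable with respect to area measure. $\mathcal{R}_n(\mathbb{D})$ denotes the set of rational functions of degree at most $n$ with poles outside the closed disc $\overline{\mathbb{D}}$, and $$R_n(f,H^p)=\inf\{\|f-g\|_{H^p} : g\in\mathcal{R}_n(\mathbb{D})\}.$$ *)

theory Defs
  imports
    "HOL-Complex_Analysis.Complex_Analysis"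
    "HOL-Computational_Algebra.Computational_Algebra"
begin

text \<open>
  Functions on the unit disc are represented by total functions on the complex plane, of which
  only the values on \<open>ball 0 1\<close> are relevant.
\<close>

text \<open>
  The integral means
  \<open>M_p(r,f) = (1/(2\<pi>) \<integral>_0^{2\<pi>} |f(r e^{it})|^p dt)^{1/p}\<close> and
  \<open>M_\<infinity>(r,f) = max_t |f(r e^{it})|\<close>. They are only meaningful for \<open>p > 0\<close>
  and \<open>f\<close> continuous on the circle of radius \<open>r\<close>.
\<close>

definition integral_mean :: "ennreal \<Rightarrow> real \<Rightarrow> (complex \<Rightarrow> complex) \<Rightarrow> real" where
  "integral_mean p r f =
     (if p = \<infinity> then (SUP t\<in>{0..2*pi}. norm (f (of_real r * cis t)))
      else ((1 / (2*pi)) * (LBINT t:{0..2*pi}. norm (f (of_real r * cis t)) powr enn2real p))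
             powr (1 / enn2real p))"

definition hardy_space :: "ennreal \<Rightarrow> (complex \<Rightarrow> complex) set" where
  "hardy_space p =
     {f. f holomorphic_on ball 0 1 \<and> bdd_above ((\<lambda>r. integral_mean p r f) ` {0..<1})}"

text \<open>A real supremum, hence meaningful only on \<open>hardy_space p\<close>.\<close>

definition hardy_norm :: "ennreal \<Rightarrow> (complex \<Rightarrow> complex) \<Rightarrow> real" where
  "hardy_norm p f = (SUP r\<in>{0..<1}. integral_mean p r f)"

definition bergman_space_1 :: "(complex \<Rightarrow> complex) set" where
  "bergman_space_1 = {g. g holomorphic_on ball 0 1 \<and> set_integrable lborel (ball 0 1) g}"

text \<open>
  The degree of a rational function is the maximum of the degrees of numerator and denominator in
  lowest terms, and its finite poles are the zeros of that denominator. A pole at infinity is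
  outside the closed disc, so polynomials of degree at most \<open>n\<close> are included.
\<close>

definition rational_functions :: "nat \<Rightarrow> (complex \<Rightarrow> complex) set" where
  "rational_functions n =
     {(\<lambda>z. poly P z / poly Q z) | P Q :: complex poly.
        coprime P Q \<and> max (degree P) (degree Q) \<le> n \<and> (\<forall>z\<in>cball 0 1. poly Q z \<noteq> 0)}"

definition rational_approx :: "nat \<Rightarrow> (complex \<Rightarrow> complex) \<Rightarrow> ennreal \<Rightarrow> real" where
  "rational_approx n f p = (INF g\<in>rational_functions n. hardy_norm p (\<lambda>z. f z - g z))"

end

theory Submission
  imports Defs
begin

text \<open>
  The key is the Bernstein inequality
  \<open>\<integral>\<^sub>D |r'| dA \<le> C\<^sub>p sqrt (ln n) \<parallel>r\<parallel>\<^sub>p\<close>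
  for rational \<open>r\<close> of degree \<open>n\<close> with poles off the closed disc. Put \<open>1/q = 1 - 1/p\<close> and
  \<open>\<delta> = n\<close> to the power \<open>-2q\<close>.
  For \<open>|z| \<le> 1 - \<delta>\<close> write \<open>r = u v\<close> with \<open>u, v\<close> in \<open>H\<^sup>2\<close> (Riesz factorisation); weighting
  \<open>|u' v|\<close> by \<open>1 - |z|\<close> and its inverse, Parseval bounds the integral by
  \<open>\<parallel>r\<parallel>\<^sub>1 sqrt (ln (1/\<delta>))\<close>.
  For \<open>|z| > 1 - \<delta>\<close> a reproducing kernel of the model space attached to the poles of \<open>r\<close> bounds
  \<open>|r'|\<close> pointwise by a sum over the poles, and Hoelder's inequality (here \<open>p > 1\<close> is needed) gives an
  integral of order \<open>n\<^sup>2 \<delta>\<^bsup>1/q\<^esup> = 1\<close>.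

  The theorem follows by telescoping near-best approximants of degree \<open>2\<close> to the \<open>2\<^sup>k\<close>: along these
  degrees \<open>sqrt (ln n)\<close> is comparable to the sum of \<open>1 / (n sqrt (ln n))\<close> over the preceding block,
  so the hypothesis makes the Bernstein bounds summable. The case \<open>p = \<infinity>\<close> is treated with exponent 2.
\<close>

section \<open>Area integrals\<close>

text \<open>The factor sqrt (ln n) has a single source: the integral of |v|^2 / (1 - |z|) over the
  disc of radius 1 - \<delta> grows like ln (1/\<delta>), while |u'|^2 (1 - |z|) is integrable over
  the whole disc, and Cauchy-Schwarz takes the square root of the logarithm. This argument never
  sees the degree and breaks down as \<delta> tends to 0, so near the circle the degree has to
  enter. There a crude bound is affordable: replacing \<delta> by a fixed power of itself changes
  sqrt (ln (1/\<delta>)) by a constant factor only, so a loss polynomial in n can be absorbed by a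
  power of \<delta>. What must be positive for this is the exponent 1/q, since (1 - |z|)^(1/q - 1)
  has to be integrable up to the circle. No boundary values of f are used: f is evaluated only on
  circles of radius less than 1, and f' is reached from the derivatives of the approximants by
  Fatou's lemma.\<close>

lemma nn_integral_complex_translate:
  fixes F :: "complex \<Rightarrow> ennreal"
  assumes [measurable]: "F \<in> borel_measurable borel"
  shows "(\<integral>\<^sup>+z. F (z + c) \<partial>lborel) = (\<integral>\<^sup>+z. F z \<partial>lborel)"
proof -
  have "(\<integral>\<^sup>+z. F z \<partial>distr lborel borel ((+) c)) = (\<integral>\<^sup>+z. F (c + z) \<partial>lborel)"
    by (subst nn_integral_distr) auto
  then show ?thesis
    by (simp add: lborel_distr_plus add.commute)
qed

lemma emeasure_complex_ball:
  "r \<ge> 0 \<Longrightarrow> emeasure lborel (ball (c::complex) r) = ennreal (pi * r^2)"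
  "r \<ge> 0 \<Longrightarrow> emeasure lborel (cball (c::complex) r) = ennreal (pi * r^2)"
  by (simp_all add: emeasure_ball emeasure_cball unit_ball_vol_2)

text \<open>
  Convolving with the rotation-invariant indicator of the disc reduces rotation invariance of
  \<open>lborel\<close> to translation invariance and Tonelli.
\<close>
lemma nn_integral_rotate:
  fixes F :: "complex \<Rightarrow> ennreal"
  assumes F[measurable]: "F \<in> borel_measurable borel" and w: "norm w = 1"
  shows "(\<integral>\<^sup>+z. F (w * z) \<partial>lborel) = (\<integral>\<^sup>+z. F z \<partial>lborel)"
proof -
  define \<kappa> :: "complex \<Rightarrow> ennreal" where "\<kappa> = indicator (ball 0 1)"
  have [measurable]: "\<kappa> \<in> borel_measurable borel"
    unfolding \<kappa>_def by (intro borel_measurable_indicator) auto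
  have \<kappa>w: "\<kappa> (- w * z) = \<kappa> z" for z
    by (simp add: \<kappa>_def indicator_def norm_mult w)
  have "cnj w * w = 1"
    using w by (metis complex_norm_square mult.commute of_real_1 one_power2)
  then have ww: "w * (cnj w * y) = y" for y
    by (metis mult.assoc mult.commute mult_1)
  have \<kappa>int: "(\<integral>\<^sup>+y. \<kappa> y \<partial>lborel) = ennreal pi"
    unfolding \<kappa>_def by (simp add: emeasure_complex_ball)
  have "ennreal pi * (\<integral>\<^sup>+z. F (w * z) \<partial>lborel) 
      = (\<integral>\<^sup>+z. F (w * z) * (\<integral>\<^sup>+y. \<kappa> y \<partial>lborel) \<partial>lborel)"
    by (subst nn_integral_multc) (auto simp: \<kappa>int mult.commute)
  also have "\<dots> = (\<integral>\<^sup>+z. F (w * z) * (\<integral>\<^sup>+y. \<kappa> (y + - (w * z)) \<partial>lborel) \<partial>lborel)"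
    by (subst nn_integral_complex_translate) auto
  also have "\<dots> = (\<integral>\<^sup>+z. (\<integral>\<^sup>+y. F (w * z) * \<kappa> (y - w * z) \<partial>lborel) \<partial>lborel)"
    by (subst nn_integral_cmult[symmetric]) (auto simp del: complex_mult_cnj)
  also have "\<dots> = (\<integral>\<^sup>+y. (\<integral>\<^sup>+z. F (w * z) * \<kappa> (y - w * z) \<partial>lborel) \<partial>lborel)"
    by (rule lborel_pair.Fubini') measurable
  \<comment> \<open>As |w| = 1, the shift \<open>cnj w * y\<close> is y / w. It turns
    \<open>w * z\<close> into \<open>y + w * z\<close>, so that the argument of
    \<open>\<kappa>\<close> becomes \<open>- w * z\<close>, a rotated \<open>z\<close> free of
    \<open>y\<close>.\<close>
  also have "\<dots> = (\<integral>\<^sup>+y. (\<integral>\<^sup>+z. F (w * (z + cnj w * y)) * \<kappa> (y - w * (z + cnj w * y)) \<partial>lborel) \<partial>lborel)"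
    by (intro nn_integral_cong nn_integral_complex_translate[symmetric, of "\<lambda>z. F (w * z) * \<kappa> (_ - w * z)"]) measurable
  also have "\<dots> = (\<integral>\<^sup>+y. (\<integral>\<^sup>+z. F (y + w * z) * \<kappa> z \<partial>lborel) \<partial>lborel)"
    using \<kappa>w by (simp add: distrib_left ww add.commute)
  also have "\<dots> = (\<integral>\<^sup>+z. (\<integral>\<^sup>+y. F (y + w * z) * \<kappa> z \<partial>lborel) \<partial>lborel)"
    by (rule lborel_pair.Fubini') measurable
  also have "\<dots> = (\<integral>\<^sup>+z. (\<integral>\<^sup>+y. F y \<partial>lborel) * \<kappa> z \<partial>lborel)"
    by (simp add: nn_integral_multc nn_integral_complex_translate)
  also have "\<dots> = ennreal pi * (\<integral>\<^sup>+y. F y \<partial>lborel)"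
    by (simp add: nn_integral_cmult nn_integral_multc \<kappa>int mult.commute)
  finally show ?thesis
    by (simp add: ennreal_mult_cancel_left)
qed

text \<open>Every rotation preserves the area integral, so the average over \<open>t\<close> does
  too. Together with \<open>nn_integral_radial\<close> this does the work of polar coordinates: the
  inner integral depends on \<open>norm z\<close> only.\<close>

lemma nn_integral_circle_average:
  fixes F :: "complex \<Rightarrow> ennreal"
  assumes [measurable]: "F \<in> borel_measurable borel"
  shows "ennreal (2*pi) * (\<integral>\<^sup>+z. F z \<partial>lborel) =
         (\<integral>\<^sup>+z. (\<integral>\<^sup>+t\<in>{0..2*pi}. F (z * cis t) \<partial>lborel) \<partial>lborel)"
proof -
  have [measurable]: "cis \<in> borel_measurable borel"
    by (intro borel_measurable_continuous_onI continuous_intros)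
  have "(\<integral>\<^sup>+z. (\<integral>\<^sup>+t\<in>{0..2*pi}. F (z * cis t) \<partial>lborel) \<partial>lborel) =
        (\<integral>\<^sup>+t. (\<integral>\<^sup>+z. F (z * cis t) * indicator {0..2*pi} t \<partial>lborel) \<partial>lborel)"
    by (rule lborel_pair.Fubini') measurable
  also have "\<dots> = (\<integral>\<^sup>+t. (\<integral>\<^sup>+z. F (cis t * z) \<partial>lborel) * indicator {0..2*pi} t \<partial>lborel)"
    by (subst nn_integral_multc) (auto simp: mult.commute)
  also have "\<dots> = (\<integral>\<^sup>+t. (\<integral>\<^sup>+z. F z \<partial>lborel) * indicator {0..2*pi} t \<partial>lborel)"
    by (subst nn_integral_rotate) auto
  also have "\<dots> = (\<integral>\<^sup>+z. F z \<partial>lborel) * ennreal (2*pi)"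
    by (subst nn_integral_cmult) auto
  finally show ?thesis by (simp add: mult.commute)
qed

text \<open>Both sides integrate \<open>\<phi>\<close> against a measure on the line: the image of
  area on the disc under \<open>norm\<close>, and the density 2 pi r on [0,1]. Such measures
  coincide once they are finite and equal on all half-lines, which is the area formula for an
  annulus.\<close>

lemma nn_integral_radial:
  fixes \<phi> :: "real \<Rightarrow> ennreal"
  assumes [measurable]: "\<phi> \<in> borel_measurable borel"
  shows "(\<integral>\<^sup>+z\<in>ball (0::complex) 1. \<phi> (norm z) \<partial>lborel) = (\<integral>\<^sup>+r\<in>{0..1}. ennreal (2*pi*r) * \<phi> r \<partial>lborel)"
proof -
  have [measurable]: "ball (0::complex) 1 \<in> sets borel" by simp
  define M where "M = distr (density lborel (indicator (ball (0::complex) 1))) borel norm"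
  define N where "N = density lborel (\<lambda>r. ennreal (2*pi*r) * indicator {0..1} r)"
  have M: "emeasure M {x<..} = emeasure lborel ({z::complex. x < norm z \<and> norm z < 1})" for x
  proof -
    have [measurable]: "ball (0::complex) 1 \<in> sets borel" by simp
    have S: "norm -` {x<..} \<in> sets (borel :: complex measure)"
      by (intro borel_open open_vimage continuous_intros)
    have "emeasure M {x<..} = (\<integral>\<^sup>+z. indicator (ball (0::complex) 1) z * indicator (norm -` {x<..}) z \<partial>lborel)"
      unfolding M_def using S by (simp add: emeasure_distr emeasure_density)
    also have "\<dots> = (\<integral>\<^sup>+z. indicator (ball (0::complex) 1 \<inter> norm -` {x<..}) z \<partial>lborel)"
      by (intro nn_integral_cong) (auto simp: indicator_def)
    also have "\<dots> = emeasure lborel (ball (0::complex) 1 \<inter> norm -` {x<..})"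
      using S by (intro nn_integral_indicator) auto
    also have "ball (0::complex) 1 \<inter> norm -` {x<..} = {z. x < norm z \<and> norm z < 1}" by auto
    finally show ?thesis .
  qed
  have N: "emeasure N {x<..} = (\<integral>\<^sup>+r. ennreal (2*pi*r) * indicator {max 0 x..1} r \<partial>lborel)" for x
  proof -
    have "emeasure N {x<..} = (\<integral>\<^sup>+r. ennreal (2*pi*r) * indicator {0..1} r * indicator {x<..} r \<partial>lborel)"
      unfolding N_def by (subst emeasure_density) auto
    also have "\<dots> = (\<integral>\<^sup>+r. ennreal (2*pi*r) * indicator {max 0 x..1} r \<partial>lborel)"
    proof (rule nn_integral_cong_AE)
      show "AE r in lborel. ennreal (2*pi*r) * indicator {0..1} r * indicator {x<..} r =
              ennreal (2*pi*r) * indicator {max 0 x..1} r"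
        using AE_lborel_singleton[of x] by eventually_elim (auto simp: indicator_def)
    qed
    finally show ?thesis .
  qed
  have eq: "emeasure M {x<..} = emeasure N {x<..} \<and> emeasure M {x<..} < \<infinity>" for x
  proof (cases "x < 1")
    case False
    have S0: "{z::complex. x < norm z \<and> norm z < 1} = {}" using False by auto
    moreover have AE0: "AE r in lborel. ennreal (2*pi*r) * indicator {max 0 x..1} r = 0"
      using AE_lborel_singleton[of 1] by eventually_elim (use False in \<open>auto simp: indicator_def\<close>)
    moreover from AE0 have "emeasure N {x<..} = 0"
      unfolding N by (subst nn_integral_0_iff_AE) auto
    ultimately show ?thesis unfolding M S0 by simp
  next
    case True
    define y where "y = max 0 x"
    have y: "0 \<le> y" "y < 1" using True by (auto simp: y_def)
    \<comment> \<open>For negative \<open>x\<close> the two sets differ at the origin, a null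
      set.\<close>
    have "AE z::complex in lborel. (z \<in> {z. x < norm z \<and> norm z < 1}) = (z \<in> ball 0 1 - cball 0 y)"
      using AE_lborel_singleton[of 0] 
      by eventually_elim (auto simp: y_def max_def split: if_splits intro: order.strict_trans2[OF _ norm_ge_zero])
    then have "emeasure M {x<..} = emeasure lborel (ball (0::complex) 1 - cball 0 y)"
      unfolding M by (intro emeasure_eq_AE) auto
    also have "\<dots> = emeasure lborel (ball (0::complex) 1) - emeasure lborel (cball (0::complex) y)"
      using y by (subst emeasure_Diff) (auto simp: emeasure_complex_ball)
    also have "\<dots> = ennreal (pi - pi * y^2)"
      using y by (simp add: emeasure_complex_ball ennreal_minus)
    finally have 1: "emeasure M {x<..} = ennreal (pi - pi * y^2)" .
    have "(\<integral>\<^sup>+r. ennreal (2*pi*r) * indicator {y..1} r \<partial>lborel) = ennreal (pi * 1^2 - pi * y^2)"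
      by (rule nn_integral_FTC_Icc[where F="\<lambda>r. pi * r^2"])
         (use y in \<open>auto intro!: derivative_eq_intros simp: has_real_derivative_iff_has_vector_derivative[symmetric]\<close>)
    then show ?thesis using 1 unfolding N by (simp add: y_def)
  qed
  have "sets M = sets borel" "sets N = sets borel" by (simp_all add: M_def N_def)
  then have "M = N"
    by (rule measure_eqI_lessThan) (use eq in blast)+
  then have "(\<integral>\<^sup>+r. \<phi> r \<partial>M) = (\<integral>\<^sup>+r. \<phi> r \<partial>N)" by simp
  then show ?thesis
    unfolding M_def N_def
    by (simp add: nn_integral_distr nn_integral_density mult_ac)
qed

text \<open>Turns bounds on circles into bounds on the disc; an inequality is enough because only
  upper estimates are wanted. Writing the circle as \<open>z * cis t\<close> for arbitrary
  \<open>z\<close> avoids choosing a base point on it.\<close>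

lemma nn_integral_disc_le:
  fixes F :: "complex \<Rightarrow> ennreal" and \<phi> :: "real \<Rightarrow> ennreal"
  assumes [measurable]: "F \<in> borel_measurable borel" "\<phi> \<in> borel_measurable borel"
    and le: "\<And>z. norm z < 1 \<Longrightarrow> (\<integral>\<^sup>+t\<in>{0..2*pi}. F (z * cis t) \<partial>lborel) \<le> ennreal (2*pi) * \<phi> (norm z)"
  shows "(\<integral>\<^sup>+z\<in>ball 0 1. F z \<partial>lborel) \<le> (\<integral>\<^sup>+r\<in>{0..1}. ennreal (2*pi*r) * \<phi> r \<partial>lborel)"
proof -
  have [measurable]: "ball (0::complex) 1 \<in> sets borel" by simp
  have "ennreal (2*pi) * (\<integral>\<^sup>+z\<in>ball 0 1. F z \<partial>lborel) =
     (\<integral>\<^sup>+z. (\<integral>\<^sup>+t\<in>{0..2*pi}. F (z * cis t) * indicator (ball 0 1) (z * cis t) \<partial>lborel) \<partial>lborel)"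
    by (rule nn_integral_circle_average) measurable
  also have "\<dots> \<le> (\<integral>\<^sup>+z. ennreal (2*pi) * (\<phi> (norm z) * indicator (ball (0::complex) 1) z) \<partial>lborel)"
  proof (rule nn_integral_mono)
    fix z :: complex
    show "(\<integral>\<^sup>+t\<in>{0..2*pi}. F (z * cis t) * indicator (ball 0 1) (z * cis t) \<partial>lborel)
        \<le> ennreal (2*pi) * (\<phi> (norm z) * indicator (ball 0 1) z)"
      using le[of z] by (auto simp: indicator_def norm_mult)
  qed
  also have "\<dots> = ennreal (2*pi) * (\<integral>\<^sup>+z. \<phi> (norm z) * indicator (ball 0 1) (z::complex) \<partial>lborel)"
    by (subst nn_integral_cmult) auto
  finally have "(\<integral>\<^sup>+z\<in>ball 0 1. F z \<partial>lborel) \<le> (\<integral>\<^sup>+z\<in>ball (0::complex) 1. \<phi> (norm z) \<partial>lborel)"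
    by (simp add: ennreal_mult_le_mult_iff)
  also note nn_integral_radial
  finally show ?thesis by simp
qed

section \<open>Parseval\<close>

lemma has_integral_cis_int:
  fixes k :: int
  shows "((\<lambda>t. cis (of_int k * t)) has_integral (if k = 0 then 2 * of_real pi else 0)) {0..2*pi}"
proof (cases "k = 0")
  case True
  have "((\<lambda>t. 1::complex) has_integral (2*pi - 0) *\<^sub>R 1) {0..2*pi}"
    using has_integral_const_real[of "1::complex" 0 "2*pi"] by simp
  with True show ?thesis by (simp add: scaleR_conv_of_real)
next
  case False
  have "((\<lambda>t. cis (of_int k * t)) has_integral
      (cis (of_int k * (2*pi)) / (\<i> * of_int k) - cis (of_int k * 0) / (\<i> * of_int k))) {0..2*pi}"
  proof (rule fundamental_theorem_of_calculus)
    fix x :: real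
    have "((\<lambda>t. cis (of_int k * t)) has_vector_derivative (\<i> * of_int k * cis (of_int k * x))) (at x within {0..2*pi})"
      unfolding has_vector_derivative_def
      by (rule has_derivative_eq_rhs, (rule derivative_eq_intros refl)+)
         (auto simp: fun_eq_iff scaleR_conv_of_real)
    from has_vector_derivative_divide[OF this, of "\<i> * of_int k"]
    show "((\<lambda>t. cis (of_int k * t) / (\<i> * of_int k)) has_vector_derivative
            cis (of_int k * x)) (at x within {0..2*pi})"
      using False by simp
  qed auto
  moreover have "cis (of_int k * (2*pi)) = 1"
    by (metis cis_multiple_2pi Ints_of_int mult.commute mult.assoc)
  ultimately show ?thesis using False by simp
qed

lemma parseval_finite:
  fixes c :: "nat \<Rightarrow> complex"
  shows "((\<lambda>t. (norm (\<Sum>n<N. c n * cis t ^ n))\<^sup>2) has_integral 2 * pi * (\<Sum>n<N. (norm (c n))\<^sup>2)) {0..2*pi}"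
proof -
  have expand: "complex_of_real ((norm (\<Sum>n<N. c n * cis t ^ n))\<^sup>2) =
      (\<Sum>m<N. \<Sum>n<N. (c m * cnj (c n)) * cis (of_int (int m - int n) * t))" for t
  proof -
    have "cis t ^ m * cnj (cis t ^ n) = cis (of_int (int m - int n) * t)" for m n
      by (simp only: Complex.DeMoivre cis_cnj cis_mult) (simp add: left_diff_distrib)
    then have "c m * cis t ^ m * cnj (c n * cis t ^ n) = (c m * cnj (c n)) * cis (of_int (int m - int n) * t)" for m n
      by (metis (no_types, lifting) complex_cnj_mult mult.assoc mult.left_commute)
    moreover have "complex_of_real ((norm (\<Sum>n<N. c n * cis t ^ n))\<^sup>2) =
       (\<Sum>m<N. c m * cis t ^ m) * cnj (\<Sum>n<N. c n * cis t ^ n)"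
      by (rule complex_norm_square)
    ultimately show ?thesis
      by (simp only: cnj_sum sum_product)
  qed
  have "((\<lambda>t. (\<Sum>m<N. \<Sum>n<N. (c m * cnj (c n)) * cis (of_int (int m - int n) * t))) has_integral
       (\<Sum>m<N. \<Sum>n<N. (c m * cnj (c n)) * (if int m - int n = 0 then 2 * of_real pi else 0))) {0..2*pi}"
    by (intro has_integral_sum has_integral_mult_right has_integral_cis_int) auto
  also have "(\<Sum>m<N. \<Sum>n<N. (c m * cnj (c n)) * (if int m - int n = 0 then 2 * of_real pi else 0))
      = (\<Sum>m<N. 2 * of_real pi * of_real ((norm (c m))\<^sup>2))"
  proof (rule sum.cong[OF refl])
    fix m assume m: "m \<in> {..<N}"
    have "(\<Sum>n<N. (c m * cnj (c n)) * (if int m - int n = 0 then 2 * of_real pi else 0)) =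
          (\<Sum>n<N. if n = m then c m * cnj (c m) * (2 * of_real pi) else 0)"
      by (rule sum.cong) auto
    also have "\<dots> = c m * cnj (c m) * (2 * of_real pi)"
      using m by (simp add: sum.delta)
    finally show "(\<Sum>n<N. (c m * cnj (c n)) * (if int m - int n = 0 then 2 * of_real pi else 0)) =
       2 * of_real pi * of_real ((norm (c m))\<^sup>2)"
      by (simp only: complex_norm_square mult_ac)
  qed
  also have "\<dots> = of_real (2 * pi * (\<Sum>n<N. (norm (c n))\<^sup>2))"
    by (simp add: sum_distrib_left)
  finally have "((\<lambda>t. complex_of_real ((norm (\<Sum>n<N. c n * cis t ^ n))\<^sup>2)) has_integral
       of_real (2 * pi * (\<Sum>n<N. (norm (c n))\<^sup>2))) {0..2*pi}"
    by (simp only: expand)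
  then have "((Re \<circ> (\<lambda>t. complex_of_real ((norm (\<Sum>n<N. c n * cis t ^ n))\<^sup>2))) has_integral
       Re (of_real (2 * pi * (\<Sum>n<N. (norm (c n))\<^sup>2)))) {0..2*pi}"
    by (rule has_integral_linear[OF _ bounded_linear_Re])
  then show ?thesis by (simp add: o_def)
qed

text \<open>Absolute summability bounds all partial sums by one constant, so
  \<open>parseval_finite\<close> passes to the limit by dominated convergence. Taylor coefficients
  satisfy it on every circle inside the open disc.\<close>

lemma parseval:
  fixes c :: "nat \<Rightarrow> complex"
  assumes sm: "summable (\<lambda>n. norm (c n))"
  shows "((\<lambda>t. (norm (\<Sum>n. c n * cis t ^ n))\<^sup>2) has_integral 2 * pi * (\<Sum>n. (norm (c n))\<^sup>2)) {0..2*pi}"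
    and "summable (\<lambda>n. (norm (c n))\<^sup>2)"
proof -
  have smt: "summable (\<lambda>n. norm (c n * cis t ^ n))" for t
    using sm by (simp add: norm_mult norm_power)
  let ?f = "\<lambda>N t. (norm (\<Sum>n<N. c n * cis t ^ n))\<^sup>2"
  have 0: "?f N integrable_on {0..2*pi}" for N
    using parseval_finite[where N=N and c=c] by blast
  have 1: "norm (?f N t) \<le> (\<Sum>n. norm (c n))\<^sup>2" for N t
  proof -
    have "norm (\<Sum>n<N. c n * cis t ^ n) \<le> (\<Sum>n<N. norm (c n * cis t ^ n))" by (rule norm_sum)
    also have "\<dots> = (\<Sum>n<N. norm (c n))" by (simp add: norm_mult norm_power)
    also have "\<dots> \<le> (\<Sum>n. norm (c n))" by (rule sum_le_suminf) (use sm in auto)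
    finally show ?thesis by (simp add: power_mono)
  qed
  have 2: "(\<lambda>N. ?f N t) \<longlonglongrightarrow> (norm (\<Sum>n. c n * cis t ^ n))\<^sup>2" for t
    by (intro tendsto_intros summable_LIMSEQ summable_norm_cancel[OF smt])
  note dc = dominated_convergence[of ?f "{0..2*pi}" "\<lambda>_. (\<Sum>n. norm (c n))\<^sup>2",
     OF 0 integrable_const_ivl 1 2]
  have "integral {0..2*pi} (?f N) = 2 * pi * (\<Sum>n<N. (norm (c n))\<^sup>2)" for N
    by (rule integral_unique[OF parseval_finite])
  with dc(2) have "(\<lambda>N. 2 * pi * (\<Sum>n<N. (norm (c n))\<^sup>2)) \<longlonglongrightarrow> 
     integral {0..2*pi} (\<lambda>t. (norm (\<Sum>n. c n * cis t ^ n))\<^sup>2)"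
    by simp
  then have "(\<lambda>N. (2 * pi * (\<Sum>n<N. (norm (c n))\<^sup>2)) / (2*pi)) \<longlonglongrightarrow> 
     integral {0..2*pi} (\<lambda>t. (norm (\<Sum>n. c n * cis t ^ n))\<^sup>2) / (2*pi)"
    by (intro tendsto_divide tendsto_const) auto
  then have "(\<lambda>n. (norm (c n))\<^sup>2) sums (integral {0..2*pi} (\<lambda>t. (norm (\<Sum>n. c n * cis t ^ n))\<^sup>2) / (2*pi))"
    by (simp add: sums_def)
  from sums_unique[OF this] sums_summable[OF this] dc(1)
  show "((\<lambda>t. (norm (\<Sum>n. c n * cis t ^ n))\<^sup>2) has_integral 2 * pi * (\<Sum>n. (norm (c n))\<^sup>2)) {0..2*pi}"
    and "summable (\<lambda>n. (norm (c n))\<^sup>2)"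
    by (auto simp: has_integral_iff field_simps)
qed

lemma nn_integral_circle:
  fixes f :: "real \<Rightarrow> real"
  assumes "(f has_integral I) {0..2*pi}" "\<And>t. t \<in> {0..2*pi} \<Longrightarrow> f t \<ge> 0"
  shows "(\<integral>\<^sup>+t\<in>{0..2*pi}. ennreal (f t) \<partial>lborel) = ennreal I"
proof -
  have "(\<integral>\<^sup>+t. ennreal (indicator {0..2*pi} t * f t) \<partial>lborel) = ennreal I"
    by (rule nn_integral_has_integral_lebesgue[OF assms(2,1)])
  moreover have "ennreal (f t) * indicator {0..2*pi} t = ennreal (indicator {0..2*pi} t * f t)" for t
    by (auto simp: indicator_def)
  ultimately show ?thesis by simp
qed

section \<open>Taylor coefficients and weighted area integrals\<close>

definition taylor :: "(complex \<Rightarrow> complex) \<Rightarrow> nat \<Rightarrow> complex" where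
  "taylor f n = (deriv ^^ n) f 0 / fact n"

lemma taylor_deriv: "taylor (deriv f) n = of_nat (Suc n) * taylor f (Suc n)"
  by (simp add: taylor_def funpow_Suc_right field_simps del: funpow.simps of_nat_Suc)

context
  fixes f :: "complex \<Rightarrow> complex"
  assumes hol: "f holomorphic_on ball 0 1"
begin

lemma taylor_sums: "norm z < 1 \<Longrightarrow> (\<lambda>n. taylor f n * z ^ n) sums f z"
  using holomorphic_power_series[OF hol, of z] by (simp add: taylor_def)

lemma taylor_abs_summable:
  assumes z: "norm z < 1"
  shows "summable (\<lambda>n. norm (taylor f n * z ^ n))"
proof -
  obtain r where r: "norm z < r" "r < 1" using z dense by blast
  have "summable (\<lambda>n. taylor f n * of_real r ^ n)"
    using taylor_sums[of "of_real r"] r norm_ge_zero[of z] by (simp add: sums_iff)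
  from powser_insidea[OF this] r show ?thesis by simp
qed

text \<open>Parseval for the coefficients \<open>taylor f n * z ^ n\<close>: the argument of
  \<open>z\<close> is absorbed there and disappears with the absolute values.\<close>

lemma parseval_taylor:
  assumes z: "norm z < 1"
  shows "((\<lambda>t. (norm (f (z * cis t)))\<^sup>2) has_integral 
            2 * pi * (\<Sum>n. (norm (taylor f n))\<^sup>2 * norm z ^ (2*n))) {0..2*pi}"
    and "summable (\<lambda>n. (norm (taylor f n))\<^sup>2 * norm z ^ (2*n))"
proof -
  have "(\<Sum>n. (taylor f n * z ^ n) * cis t ^ n) = f (z * cis t)" for t
    using taylor_sums[of "z * cis t"] z by (simp add: sums_iff norm_mult power_mult_distrib mult.assoc)
  moreover have "(norm (taylor f n * z ^ n))\<^sup>2 = (norm (taylor f n))\<^sup>2 * norm z ^ (2*n)" for n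
    by (simp add: norm_mult norm_power power_mult_distrib power_mult[symmetric] mult.commute)
  ultimately show "((\<lambda>t. (norm (f (z * cis t)))\<^sup>2) has_integral 
            2 * pi * (\<Sum>n. (norm (taylor f n))\<^sup>2 * norm z ^ (2*n))) {0..2*pi}"
    and "summable (\<lambda>n. (norm (taylor f n))\<^sup>2 * norm z ^ (2*n))"
    using parseval[OF taylor_abs_summable[OF z]] by simp_all
qed

text \<open>Converts an H^2 bound into a bound for the coefficients. For fixed \<open>K\<close> the
  weighted partial sum is a polynomial in \<open>r\<close>, so letting \<open>r\<close> tend to 1
  needs no exchange of limits.\<close>

lemma taylor_bound:
  assumes m: "\<And>r. 0 \<le> r \<Longrightarrow> r < 1 \<Longrightarrow> integral {0..2*pi} (\<lambda>t. (norm (f (of_real r * cis t)))\<^sup>2) \<le> 2 * pi * m"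
  shows "summable (\<lambda>n. (norm (taylor f n))\<^sup>2)" "(\<Sum>n. (norm (taylor f n))\<^sup>2) \<le> m"
proof -
  have le: "(\<Sum>n<K. (norm (taylor f n))\<^sup>2) \<le> m" for K
  proof (rule tendsto_upperbound)
    show "((\<lambda>r::real. (\<Sum>n<K. (norm (taylor f n))\<^sup>2 * r ^ (2*n))) \<longlongrightarrow> (\<Sum>n<K. (norm (taylor f n))\<^sup>2)) (at_left 1)"
      by (rule tendsto_eq_intros refl | simp)+
    show "\<forall>\<^sub>F r in at_left 1. (\<Sum>n<K. (norm (taylor f n))\<^sup>2 * r ^ (2*n)) \<le> m"
    proof (rule eventually_at_leftI[of 0])
      fix r :: real assume r: "r \<in> {0<..<1}"
      then have n: "norm (of_real r :: complex) < 1" by simp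
      have "(\<Sum>n<K. (norm (taylor f n))\<^sup>2 * r ^ (2*n)) \<le> (\<Sum>n. (norm (taylor f n))\<^sup>2 * r ^ (2*n))"
        using parseval_taylor(2)[OF n] r by (intro sum_le_suminf) auto
      moreover have "2 * pi * (\<Sum>n. (norm (taylor f n))\<^sup>2 * r ^ (2*n)) \<le> 2 * pi * m"
        using m[of r] r integral_unique[OF parseval_taylor(1)[OF n]] by simp
      ultimately show "(\<Sum>n<K. (norm (taylor f n))\<^sup>2 * r ^ (2*n)) \<le> m" by simp
    qed simp
  qed simp
  show "summable (\<lambda>n. (norm (taylor f n))\<^sup>2)"
    by (rule summableI_nonneg_bounded[where x=m]) (use le in auto)
  then show "(\<Sum>n. (norm (taylor f n))\<^sup>2) \<le> m"
    using le by (rule suminf_le_const)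
qed

end

text \<open>Nothing is known about \<open>f\<close> off the disc, so only the truncation is
  measurable; the area estimates below therefore work with such truncations.\<close>

lemma borel_measurable_on_disc:
  fixes f :: "complex \<Rightarrow> complex"
  assumes "f holomorphic_on ball 0 1"
  shows "(\<lambda>z. indicator (ball 0 1) z *\<^sub>R f z) \<in> borel_measurable borel"
  by (intro borel_measurable_continuous_on_indicator holomorphic_on_imp_continuous_on assms) auto

context
  fixes f :: "complex \<Rightarrow> complex" and m :: real
  assumes hol: "f holomorphic_on ball 0 1"
    and m: "\<And>r. 0 \<le> r \<Longrightarrow> r < 1 \<Longrightarrow> integral {0..2*pi} (\<lambda>t. (norm (f (of_real r * cis t)))\<^sup>2) \<le> 2 * pi * m"
begin

lemma square_mean_le:
  assumes z: "norm z < 1"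
  shows "(\<integral>\<^sup>+t\<in>{0..2*pi}. ennreal ((norm (f (z * cis t)))\<^sup>2) \<partial>lborel) \<le> ennreal (2 * pi * m)"
proof -
  have "(\<Sum>n. (norm (taylor f n))\<^sup>2 * norm z ^ (2*n)) \<le> (\<Sum>n. (norm (taylor f n))\<^sup>2)"
    using z by (intro suminf_le parseval_taylor[OF hol] taylor_bound[OF hol m] mult_left_le power_le_one) auto
  also have "\<dots> \<le> m"
    by (rule taylor_bound[OF hol m])
  finally show ?thesis
    by (subst nn_integral_circle[OF parseval_taylor(1)[OF hol z]]) (auto intro!: ennreal_leI)
qed

text \<open>The upper half of the Littlewood-Paley formula. Differentiation multiplies the squared
  coefficients by (n+1)^2, while the radial integral of r^(2n+1) (1 - r) is of order 1/(n+1)^2; the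
  weight compensates exactly, leaving the sum of the squared coefficients of
  \<open>f\<close>.\<close>

lemma littlewood_paley_le:
  "(\<integral>\<^sup>+z\<in>ball 0 1. ennreal ((norm (deriv f z))\<^sup>2 * (1 - norm z)) \<partial>lborel) \<le> ennreal (pi / 2 * m)"
proof -
  have hol': "deriv f holomorphic_on ball 0 1"
    using hol by (rule holomorphic_deriv) simp
  define G where "G z = indicator (ball 0 1) z *\<^sub>R deriv f z" for z
  have [measurable]: "G \<in> borel_measurable borel"
    unfolding G_def[abs_def] by (rule borel_measurable_on_disc[OF hol'])
  have G: "norm z < 1 \<Longrightarrow> G z = deriv f z" for z by (simp add: G_def)
  define b where "b n = (norm (taylor (deriv f) n))\<^sup>2" for n
  have b: "b n \<ge> 0" for n by (simp add: b_def)
  have b_eq: "b n = (real n + 1)^2 * (norm (taylor f (Suc n)))\<^sup>2" for n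
    by (simp add: b_def taylor_deriv norm_mult power_mult_distrib add.commute del: of_nat_Suc)
  have sm: "summable (\<lambda>n. (norm (taylor f (Suc n)))\<^sup>2)"
    using taylor_bound(1)[OF hol m] by (subst summable_Suc_iff)
  \<comment> \<open>Kept as a series in \<open>ennreal\<close>, so that measurability and the
    exchange of sum and integral need no convergence argument.\<close>
  define \<phi> where "\<phi> r = (\<Sum>n. ennreal (b n * r ^ (2*n) * (1 - r)))" for r
  have [measurable]: "\<phi> \<in> borel_measurable borel"
    unfolding \<phi>_def[abs_def] by measurable
  have "(\<integral>\<^sup>+z\<in>ball 0 1. ennreal ((norm (deriv f z))\<^sup>2 * (1 - norm z)) \<partial>lborel)
      = (\<integral>\<^sup>+z\<in>ball 0 1. ennreal ((norm (G z))\<^sup>2 * (1 - norm z)) \<partial>lborel)"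
    by (intro nn_integral_cong) (auto simp: indicator_def G)
  also have "\<dots> \<le> (\<integral>\<^sup>+r\<in>{0..1}. ennreal (2*pi*r) * \<phi> r \<partial>lborel)"
  proof (rule nn_integral_disc_le)
    fix z :: complex assume z: "norm z < 1"
    note P = parseval_taylor[OF hol' z]
    have "((\<lambda>t. (norm (G (z * cis t)))\<^sup>2 * (1 - norm (z * cis t))) has_integral 
          (2 * pi * (\<Sum>n. b n * norm z ^ (2*n))) * (1 - norm z)) {0..2*pi}"
      using has_integral_mult_left[OF P(1), of "1 - norm z"] z by (simp add: norm_mult b_def G)
    then have "(\<integral>\<^sup>+t\<in>{0..2*pi}. ennreal ((norm (G (z * cis t)))\<^sup>2 * (1 - norm (z * cis t))) \<partial>lborel)
        = ennreal ((2 * pi * (\<Sum>n. b n * norm z ^ (2*n))) * (1 - norm z))"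
      by (rule nn_integral_circle) (use z in \<open>auto simp: norm_mult\<close>)
    also have "\<dots> = ennreal (2*pi * ((\<Sum>n. b n * norm z ^ (2*n) * (1 - norm z))))"
      using suminf_mult2[OF P(2), of "1 - norm z"] by (simp only: b_def mult.assoc[of "2*pi"])
    also have "\<dots> = ennreal (2*pi) * ennreal (\<Sum>n. b n * norm z ^ (2*n) * (1 - norm z))"
      by (rule ennreal_mult') simp
    also have "ennreal (\<Sum>n. b n * norm z ^ (2*n) * (1 - norm z)) = \<phi> (norm z)"
      unfolding \<phi>_def using P(2) z
      by (intro suminf_ennreal_eq[symmetric] summable_sums summable_mult2) (auto simp: b_def)
    finally show "(\<integral>\<^sup>+t\<in>{0..2*pi}. ennreal ((norm (G (z * cis t)))\<^sup>2 * (1 - norm (z * cis t))) \<partial>lborel)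
        \<le> ennreal (2*pi) * \<phi> (norm z)" by simp
  qed measurable
  also have "\<dots> = (\<integral>\<^sup>+r. (\<Sum>n. ennreal (2*pi*r * (b n * r ^ (2*n) * (1 - r))) * indicator {0..1} r) \<partial>lborel)"
  proof (rule nn_integral_cong)
    fix r :: real
    show "ennreal (2*pi*r) * \<phi> r * indicator {0..1} r = 
       (\<Sum>n. ennreal (2*pi*r * (b n * r ^ (2*n) * (1 - r))) * indicator {0..1} r)"
    proof (cases "r \<in> {0..1}")
      case True
      have "ennreal (2*pi*r) * \<phi> r = (\<Sum>n. ennreal (2*pi*r) * ennreal (b n * r ^ (2*n) * (1 - r)))"
        unfolding \<phi>_def by simp
      also have "\<dots> = (\<Sum>n. ennreal (2*pi*r * (b n * r ^ (2*n) * (1 - r))))"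
        using True by (intro suminf_cong ennreal_mult'[symmetric]) simp
      finally show ?thesis using True by simp
    qed simp
  qed
  also have "\<dots> = (\<Sum>n. (\<integral>\<^sup>+r. ennreal (2*pi*r * (b n * r ^ (2*n) * (1 - r))) * indicator {0..1} r \<partial>lborel))"
    by (rule nn_integral_suminf) measurable
  also have "\<dots> \<le> (\<Sum>n. ennreal (pi/2 * (norm (taylor f (Suc n)))\<^sup>2))"
  proof (rule suminf_le)
    fix n
    have "(\<integral>\<^sup>+r. ennreal (2*pi*r * (b n * r ^ (2*n) * (1 - r))) * indicator {0..1} r \<partial>lborel)
      = ennreal (2*pi*b n * (1 ^ (2*n+2) / real (2*n+2) - 1 ^ (2*n+3) / real (2*n+3)) - 
                 2*pi*b n * (0 ^ (2*n+2) / real (2*n+2) - 0 ^ (2*n+3) / real (2*n+3)))"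
    proof (rule nn_integral_FTC_Icc[where F="\<lambda>r. 2*pi*b n * (r ^ (2*n+2) / real (2*n+2) - r ^ (2*n+3) / real (2*n+3))"])
      fix x :: real assume "x \<in> {0..1}" then have x: "0 \<le> x" "x \<le> 1" by auto
      show "0 \<le> 2*pi*x * (b n * x ^ (2*n) * (1 - x))" using x b by simp
      have e: "2*n+2 - Suc 0 = Suc (2*n)" "2*n+3 - Suc 0 = Suc (Suc (2*n))" by simp_all
      have p: "((\<lambda>r. r ^ (2*n+2)) has_real_derivative real (2*n+2) * x ^ Suc (2*n)) (at x)"
        "((\<lambda>r. r ^ (2*n+3)) has_real_derivative real (2*n+3) * x ^ Suc (Suc (2*n))) (at x)"
        by (metis DERIV_pow e)+
      have "((\<lambda>r. 2*pi*b n * (r ^ (2*n+2) / real (2*n+2) - r ^ (2*n+3) / real (2*n+3))) has_real_derivative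
         2*pi*b n * (real (2*n+2) * x ^ Suc (2*n) / real (2*n+2) - real (2*n+3) * x ^ Suc (Suc (2*n)) / real (2*n+3)))
            (at x)"
        by (intro DERIV_cmult DERIV_diff DERIV_cdivide p)
      also have "real (2*n+2) * x ^ Suc (2*n) / real (2*n+2) = x ^ Suc (2*n)"
        by (rule nonzero_mult_div_cancel_left) simp
      also have "real (2*n+3) * x ^ Suc (Suc (2*n)) / real (2*n+3) = x ^ Suc (Suc (2*n))"
        by (rule nonzero_mult_div_cancel_left) simp
      finally show "((\<lambda>r. 2*pi*b n * (r ^ (2*n+2) / real (2*n+2) - r ^ (2*n+3) / real (2*n+3))) has_real_derivative
           2*pi*x * (b n * x ^ (2*n) * (1 - x))) (at x)"
        by (simp add: algebra_simps)
    qed auto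
    also have "2*pi*b n * (1 ^ (2*n+2) / real (2*n+2) - 1 ^ (2*n+3) / real (2*n+3)) - 
                 2*pi*b n * (0 ^ (2*n+2) / real (2*n+2) - 0 ^ (2*n+3) / real (2*n+3)) = 
            2*pi*b n / (real (2*n+2) * real (2*n+3))"
      by (simp add: field_simps power_0_left)
    \<comment> \<open>Lowering 2n+3 to 2n+2 makes the denominator 4 (n+1)^2, which cancels the
      factor in \<open>b_eq\<close>.\<close>
    also have "\<dots> \<le> 2*pi*b n / real (2*n+2)^2"
      using b by (intro divide_left_mono) (auto simp: power2_eq_square)
    also have "\<dots> = pi/2 * (norm (taylor f (Suc n)))\<^sup>2"
    proof -
      have "real (2*n+2) = 2 * (real n + 1)" by simp
      then show ?thesis by (simp only: b_eq power_mult_distrib) (simp add: divide_simps)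
    qed
    finally show "(\<integral>\<^sup>+r. ennreal (2*pi*r * (b n * r ^ (2*n) * (1 - r))) * indicator {0..1} r \<partial>lborel)
       \<le> ennreal (pi/2 * (norm (taylor f (Suc n)))\<^sup>2)"
      by (simp add: ennreal_leI)
  qed auto
  also have "\<dots> = ennreal (\<Sum>n. pi/2 * (norm (taylor f (Suc n)))\<^sup>2)"
    by (rule suminf_ennreal_eq[OF _ summable_sums[OF summable_mult[OF sm]]]) simp
  also have "\<dots> \<le> ennreal (pi/2 * m)"
  proof (rule ennreal_leI)
    have "(\<Sum>n. pi/2 * (norm (taylor f (Suc n)))\<^sup>2) = pi/2 * (\<Sum>n. (norm (taylor f (Suc n)))\<^sup>2)"
      by (rule suminf_mult[OF sm])
    also have "(\<Sum>n. (norm (taylor f (Suc n)))\<^sup>2) = (\<Sum>n. (norm (taylor f n))\<^sup>2) - (norm (taylor f 0))\<^sup>2"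
      by (rule suminf_split_head[OF taylor_bound(1)[OF hol m]])
    also have "\<dots> \<le> (\<Sum>n. (norm (taylor f n))\<^sup>2)" by simp
    also have "\<dots> \<le> m" by (rule taylor_bound(2)[OF hol m])
    finally show "(\<Sum>n. pi/2 * (norm (taylor f (Suc n)))\<^sup>2) \<le> pi/2 * m" by simp
  qed
  finally show ?thesis .
qed

text \<open>All circle means of |f|^2 are at most \<open>m\<close>, so the bound is the integral of
  1/(1-r) up to 1 - d. Its divergence as \<open>d\<close> tends to 0 is what confines this method to
  an inner disc.\<close>

lemma square_area_le:
  assumes d: "0 < d" "d \<le> 1" and m0: "m \<ge> 0"
  shows "(\<integral>\<^sup>+z\<in>cball 0 (1-d). ennreal ((norm (f z))\<^sup>2 / (1 - norm z)) \<partial>lborel) \<le> ennreal (2 * pi * m * ln (1/d))"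
proof -
  define G where "G z = indicator (ball 0 1) z *\<^sub>R f z" for z
  have [measurable]: "G \<in> borel_measurable borel"
    unfolding G_def[abs_def] by (rule borel_measurable_on_disc[OF hol])
  have G: "norm z < 1 \<Longrightarrow> G z = f z" for z by (simp add: G_def)
  define \<phi> :: "real \<Rightarrow> ennreal" where "\<phi> r = ennreal (m / (1 - r)) * indicator {0..1-d} r" for r
  have [measurable]: "\<phi> \<in> borel_measurable borel"
    unfolding \<phi>_def[abs_def] by measurable
  define F :: "complex \<Rightarrow> ennreal" where "F z = ennreal ((norm (G z))\<^sup>2 / (1 - norm z)) * indicator {0..1-d} (norm z)" for z
  have [measurable]: "F \<in> borel_measurable borel"
    unfolding F_def[abs_def] by measurable
  have "(\<integral>\<^sup>+z\<in>cball 0 (1-d). ennreal ((norm (f z))\<^sup>2 / (1 - norm z)) \<partial>lborel)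
      = (\<integral>\<^sup>+z\<in>ball 0 1. F z \<partial>lborel)"
    by (intro nn_integral_cong) (use d in \<open>auto simp: indicator_def G F_def\<close>)
  also have "\<dots> \<le> (\<integral>\<^sup>+r\<in>{0..1}. ennreal (2*pi*r) * \<phi> r \<partial>lborel)"
  proof (rule nn_integral_disc_le)
    fix z :: complex assume z: "norm z < 1"
    have "F (z * cis t) = ennreal (1 / (1 - norm z)) * indicator {0..1-d} (norm z) * ennreal ((norm (f (z * cis t)))\<^sup>2)" for t
      using z by (cases "norm z \<in> {0..1-d}") (simp_all add: F_def G norm_mult ennreal_mult'[symmetric])
    then have "(\<integral>\<^sup>+t\<in>{0..2*pi}. F (z * cis t) \<partial>lborel) =
       (\<integral>\<^sup>+t. (ennreal (1 / (1 - norm z)) * indicator {0..1-d} (norm z)) * (ennreal ((norm (G (z * cis t)))\<^sup>2) * indicator {0..2*pi} t) \<partial>lborel)"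
      using z by (intro nn_integral_cong) (auto simp: mult_ac G norm_mult)
    also have "\<dots> = (ennreal (1 / (1 - norm z)) * indicator {0..1-d} (norm z)) * 
       (\<integral>\<^sup>+t\<in>{0..2*pi}. ennreal ((norm (G (z * cis t)))\<^sup>2) \<partial>lborel)"
    proof (rule nn_integral_cmult)
      have [measurable]: "cis \<in> borel_measurable borel"
        by (intro borel_measurable_continuous_onI continuous_intros)
      show "(\<lambda>t. ennreal ((norm (G (z * cis t)))\<^sup>2) * indicator {0..2*pi} t) \<in> borel_measurable lborel"
        by measurable
    qed
    also have "\<dots> \<le> (ennreal (1 / (1 - norm z)) * indicator {0..1-d} (norm z)) * ennreal (2*pi*m)"
      using square_mean_le[OF z] z by (intro mult_left_mono) (auto simp: G norm_mult)
    also have "\<dots> = ennreal (2*pi) * \<phi> (norm z)"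
      using z m0 by (auto simp: \<phi>_def indicator_def ennreal_mult'[symmetric])
    finally show "(\<integral>\<^sup>+t\<in>{0..2*pi}. F (z * cis t) \<partial>lborel) \<le> ennreal (2*pi) * \<phi> (norm z)" .
  qed measurable
  also have "\<dots> \<le> (\<integral>\<^sup>+r. ennreal (2*pi*m/(1-r)) * indicator {0..1-d} r \<partial>lborel)"
  proof (rule nn_integral_mono)
    fix r :: real
    have "2*pi*r*(m/(1-r)) \<le> 2*pi*1*(m/(1-r))" if "r \<in> {0..1-d}"
      using that d m0 by (intro mult_right_mono mult_left_mono) auto
    then show "ennreal (2*pi*r) * \<phi> r * indicator {0..1} r \<le> ennreal (2*pi*m/(1-r)) * indicator {0..1-d} r"
      using d m0 by (auto simp: \<phi>_def indicator_def ennreal_mult'[symmetric] intro!: ennreal_leI)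
  qed
  also have "\<dots> = ennreal (- 2*pi*m* ln (1-(1-d)) - (- 2*pi*m* ln (1-0)))"
  proof (rule nn_integral_FTC_Icc[where F="\<lambda>r. - 2*pi*m* ln (1-r)"])
    fix x assume "x \<in> {0..1-d}" then have x: "0 \<le> x" "x \<le> 1 - d" by auto
    show "((\<lambda>r. - 2*pi*m* ln (1-r)) has_real_derivative 2*pi*m/(1-x)) (at x)"
      using x d by (auto intro!: derivative_eq_intros simp: field_simps)
  qed (use d m0 in auto)
  also have "\<dots> = ennreal (2 * pi * m * ln (1/d))"
    using d by (simp add: ln_div)
  finally show ?thesis .
qed

end

section \<open>The inner disc\<close>

text \<open>\<open>k\<close> need not extend to the circle, but its square does. The square means of
  \<open>k\<close> increase with the radius by Parseval, and along radii tending to 1 they are means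
  of |H|, which converge to the boundary mean.\<close>

lemma sqrt_mean_le:
  assumes hol: "k holomorphic_on ball 0 1" and cont: "continuous_on (cball 0 1) H"
    and eq: "\<And>z. norm z < 1 \<Longrightarrow> H z = (k z)\<^sup>2" and r: "0 \<le> r" "r < 1"
  shows "integral {0..2*pi} (\<lambda>t. (norm (k (of_real r * cis t)))\<^sup>2) \<le> integral {0..2*pi} (\<lambda>t. norm (H (cis t)))"
proof -
  \<comment> \<open>\<open>s 0\<close> is \<open>r\<close> and the sequence increases to 1, so all
    radii stay in [r,1).\<close>
  define s where "s n = 1 - (1 - r) / real (Suc n)" for n
  have s: "r \<le> s n" "s n < 1" for n
    using r mult_right_mono[of r 1 "real n"] by (auto simp: s_def field_simps)
  then have s': "\<bar>s n\<bar> \<le> 1" for n using r by (smt (verit))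
  have "compact (H ` cball 0 1)" using cont by (intro compact_continuous_image) auto
  then obtain B where B: "\<And>z. norm z \<le> 1 \<Longrightarrow> norm (H z) \<le> B"
    using compact_imp_bounded bounded_iff[of "H ` cball 0 1"] by (metis imageI mem_cball_0)
  have "(\<lambda>n. integral {0..2*pi} (\<lambda>t. norm (H (of_real (s n) * cis t)))) \<longlonglongrightarrow> integral {0..2*pi} (\<lambda>t. norm (H (cis t)))"
  proof (rule dominated_convergence(2))
    show "(\<lambda>t. norm (H (of_real (s n) * cis t))) integrable_on {0..2*pi}" for n
      using s[of n] r
      by (intro integrable_continuous_interval continuous_intros continuous_on_compose2[OF cont]) (auto simp: norm_mult)
    show "(\<lambda>t. B) integrable_on {0..2*pi}" by (rule integrable_const_ivl)
    show "norm (norm (H (of_real (s n) * cis t))) \<le> B" for n t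
      using s[of n] r by (auto intro!: B simp: norm_mult)
    have "s \<longlonglongrightarrow> 1 - 0" unfolding s_def 
      by (intro tendsto_diff tendsto_const LIMSEQ_Suc[OF lim_const_over_n])
    then have "(\<lambda>n. of_real (s n) * cis t) \<longlonglongrightarrow> of_real (1 - 0) * cis t" for t
      by (intro tendsto_intros)
    then show "(\<lambda>n. norm (H (of_real (s n) * cis t))) \<longlonglongrightarrow> norm (H (cis t))" for t
      using s' 
      by (intro tendsto_norm continuous_on_tendsto_compose[OF cont]) (auto simp: norm_mult less_imp_le intro!: always_eventually)
  qed
  moreover have "integral {0..2*pi} (\<lambda>t. (norm (k (of_real r * cis t)))\<^sup>2) 
     \<le> integral {0..2*pi} (\<lambda>t. norm (H (of_real (s n) * cis t)))" for n
  proof -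
    have n: "norm (of_real (s n) :: complex) < 1" "norm (of_real r :: complex) < 1" 
      using s[of n] r by auto
    have "(\<Sum>i. (norm (taylor k i))\<^sup>2 * norm (of_real r :: complex) ^ (2*i)) \<le>
          (\<Sum>i. (norm (taylor k i))\<^sup>2 * norm (of_real (s n) :: complex) ^ (2*i))"
      using parseval_taylor(2)[OF hol n(1)] parseval_taylor(2)[OF hol n(2)] s[of n] r
      by (intro suminf_le mult_left_mono power_mono) auto
    then have "integral {0..2*pi} (\<lambda>t. (norm (k (of_real r * cis t)))\<^sup>2) \<le>
       integral {0..2*pi} (\<lambda>t. (norm (k (of_real (s n) * cis t)))\<^sup>2)"
      by (simp only: integral_unique[OF parseval_taylor(1)[OF hol n(1)]] integral_unique[OF parseval_taylor(1)[OF hol n(2)]])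
         simp
    also have "(\<lambda>t. (norm (k (of_real (s n) * cis t)))\<^sup>2) = (\<lambda>t. norm (H (of_real (s n) * cis t)))"
      using n by (auto simp: eq norm_mult norm_power)
    finally show ?thesis .
  qed
  ultimately show ?thesis by (intro LIMSEQ_le_const) auto
qed

text \<open>The product rule gives two terms symmetric in \<open>u\<close> and \<open>v\<close>.
  Each is split into a squared derivative with weight 1 - |z|, for
  \<open>littlewood_paley_le\<close>, and a squared function with the inverse weight, for
  \<open>square_area_le\<close>.\<close>

lemma deriv_product_area_le:
  assumes hol: "u holomorphic_on ball 0 1" "v holomorphic_on ball 0 1"
    and f: "\<And>z. norm z < 1 \<Longrightarrow> f z = u z * v z"
    and mu: "\<And>r. 0 \<le> r \<Longrightarrow> r < 1 \<Longrightarrow> integral {0..2*pi} (\<lambda>t. (norm (u (of_real r * cis t)))\<^sup>2) \<le> 2 * pi * m"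
    and mv: "\<And>r. 0 \<le> r \<Longrightarrow> r < 1 \<Longrightarrow> integral {0..2*pi} (\<lambda>t. (norm (v (of_real r * cis t)))\<^sup>2) \<le> 2 * pi * m"
    and d: "0 < d" "d < 1" and m0: "m \<ge> 0"
  shows "(\<integral>\<^sup>+z\<in>cball 0 (1-d). ennreal (norm (deriv f z)) \<partial>lborel) \<le> ennreal (2 * pi * m * sqrt (ln (1/d)))"
proof -
  define L where "L = ln (1/d)"
  have L: "L > 0" using d by (simp add: L_def)
  \<comment> \<open>This \<open>s\<close> minimises s/2 * (pi*m) + 4*pi*m*L / (2*s), the total that
    the two area estimates give.\<close>
  define s where "s = 2 * sqrt L"
  have s: "s > 0" using L by (simp add: s_def)
  define D where "D w z = ennreal ((norm (deriv w z))\<^sup>2 * (1 - norm z)) * indicator (ball 0 1) z" for w :: "complex \<Rightarrow> complex" and z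
  define S where "S w z = ennreal ((norm (w z))\<^sup>2 / (1 - norm z)) * indicator (cball 0 (1-d)) z" for w :: "complex \<Rightarrow> complex" and z
  have D_meas: "D w \<in> borel_measurable borel" if "w holomorphic_on ball 0 1" for w
  proof -
    have "deriv w holomorphic_on ball 0 1" using that by (rule holomorphic_deriv) simp
    from borel_measurable_on_disc[OF this]
    obtain G where G[measurable]: "G \<in> borel_measurable borel" "G = (\<lambda>z. indicator (ball 0 1) z *\<^sub>R deriv w z)"
      by blast
    have "D w = (\<lambda>z. ennreal ((norm (G z))\<^sup>2 * (1 - norm z)))"
      by (auto simp: D_def G(2) indicator_def)
    then show ?thesis by simp
  qed
  have S_meas: "S w \<in> borel_measurable borel" if "w holomorphic_on ball 0 1" for w
  proof -
    from borel_measurable_on_disc[OF that]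
    obtain G where G[measurable]: "G \<in> borel_measurable borel" "G = (\<lambda>z. indicator (ball 0 1) z *\<^sub>R w z)"
      by blast
    have [measurable]: "cball (0::complex) (1-d) \<in> sets borel" by simp
    have "S w = (\<lambda>z. ennreal ((norm (G z))\<^sup>2 / (1 - norm z)) * indicator (cball 0 (1-d)) z)"
      using d by (auto simp: S_def G(2) indicator_def)
    then show ?thesis by simp
  qed
  note [measurable] = D_meas[OF hol(1)] D_meas[OF hol(2)] S_meas[OF hol(1)] S_meas[OF hol(2)]
  \<comment> \<open>Young's inequality with weight \<open>x\<close>, later 1 - |z|. Its free
    parameter makes it as strong as Cauchy-Schwarz without taking roots of \<open>ennreal\<close>
    integrals.\<close>
  have young: "a * b \<le> s/2 * (a\<^sup>2 * x) + 1/(2 * s) * (b\<^sup>2 / x)" if "x > 0" for a b x :: real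
  proof -
    have "0 \<le> (s * a * x - b)\<^sup>2 / (2 * s * x)" using s that by simp
    also have "\<dots> = s/2 * (a\<^sup>2 * x) + 1/(2 * s) * (b\<^sup>2 / x) - a * b"
      using s that by (simp add: power2_eq_square field_simps)
    finally show ?thesis by simp
  qed
  have "(\<integral>\<^sup>+z\<in>cball 0 (1-d). ennreal (norm (deriv f z)) \<partial>lborel) \<le>
     (\<integral>\<^sup>+z. ennreal (s/2) * (D u z + D v z) + ennreal (1/(2 * s)) * (S u z + S v z) \<partial>lborel)"
  proof (rule nn_integral_mono)
    fix z :: complex
    show "ennreal (norm (deriv f z)) * indicator (cball 0 (1-d)) z \<le> 
        ennreal (s/2) * (D u z + D v z) + ennreal (1/(2 * s)) * (S u z + S v z)"
    proof (cases "z \<in> cball 0 (1-d)")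
      case True
      then have z: "z \<in> ball 0 1" using d by auto
      have "(u has_field_derivative deriv u z) (at z)" "(v has_field_derivative deriv v z) (at z)"
        using hol z by (auto intro!: holomorphic_derivI[of _ "ball 0 1"])
      then have "((\<lambda>z. u z * v z) has_field_derivative (deriv u z * v z + deriv v z * u z)) (at z)"
        by (rule DERIV_mult)
      then have "(f has_field_derivative (deriv u z * v z + deriv v z * u z)) (at z)"
        by (rule has_field_derivative_transform_within_open[of _ _ _ "ball 0 1"]) (use z f in auto)
      then have "deriv f z = deriv u z * v z + deriv v z * u z" by (rule DERIV_imp_deriv)
      then have "norm (deriv f z) \<le> norm (deriv u z) * norm (v z) + norm (deriv v z) * norm (u z)"
        by (metis norm_mult norm_triangle_ineq)
      also have "\<dots> \<le> (s/2 * ((norm (deriv u z))\<^sup>2 * (1 - norm z)) + 1/(2 * s) * ((norm (v z))\<^sup>2 / (1 - norm z)))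
          + (s/2 * ((norm (deriv v z))\<^sup>2 * (1 - norm z)) + 1/(2 * s) * ((norm (u z))\<^sup>2 / (1 - norm z)))"
        using z by (intro add_mono young) auto
      finally have "norm (deriv f z) \<le> s/2 * ((norm (deriv u z))\<^sup>2 * (1 - norm z) + (norm (deriv v z))\<^sup>2 * (1 - norm z))
            + 1/(2 * s) * ((norm (u z))\<^sup>2 / (1 - norm z) + (norm (v z))\<^sup>2 / (1 - norm z))"
        by (simp add: algebra_simps)
      then show ?thesis
        using True z s by (simp add: D_def S_def ennreal_plus[symmetric] ennreal_mult'[symmetric] ennreal_leI del: ennreal_plus)
    qed simp
  qed
  also have "\<dots> = ennreal (s/2) * (integral\<^sup>N lborel (D u) + integral\<^sup>N lborel (D v)) 
      + ennreal (1/(2 * s)) * (integral\<^sup>N lborel (S u) + integral\<^sup>N lborel (S v))"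
    by (simp add: nn_integral_add nn_integral_cmult)
  also have "\<dots> \<le> ennreal (s/2) * (ennreal (pi/2*m) + ennreal (pi/2*m)) 
      + ennreal (1/(2 * s)) * (ennreal (2*pi*m*L) + ennreal (2*pi*m*L))"
    unfolding D_def S_def L_def using d m0
    by (intro add_mono mult_left_mono littlewood_paley_le square_area_le hol mu mv) auto
  also have "\<dots> = ennreal (s/2 * (pi*m) + 1/(2 * s) * (4*pi*m*L))"
    using s m0 L by (simp add: ennreal_plus[symmetric] ennreal_mult'[symmetric] del: ennreal_plus)
  also have "s/2 * (pi*m) + 1/(2 * s) * (4*pi*m*L) = 2 * pi * m * sqrt L"
  proof -
    have "L = sqrt L * sqrt L" using L by simp
    then show ?thesis using L unfolding s_def by (simp add: field_simps)
  qed
  finally show ?thesis by (simp add: L_def)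
qed

section \<open>Moebius factors and finite Blaschke products\<close>

lemma norm_moebius_identity:
  fixes a z :: complex
  shows "(norm (1 - cnj a * z))\<^sup>2 - (norm (z - a))\<^sup>2 = (1 - (norm a)\<^sup>2) * (1 - (norm z)\<^sup>2)"
  unfolding cmod_power2 by (simp add: power2_eq_square algebra_simps)

lemma norm_moebius_le:
  fixes a z :: complex
  assumes "norm a \<le> 1" "norm z \<le> 1"
  shows "norm (z - a) \<le> norm (1 - cnj a * z)"
proof -
  have "0 \<le> (1 - (norm a)\<^sup>2) * (1 - (norm z)\<^sup>2)"
    using assms by (simp add: power_le_one)
  then show ?thesis
    unfolding norm_moebius_identity[symmetric] by (simp add: power2_le_iff_abs_le)
qed

lemma norm_moebius_eq:
  fixes a z :: complex
  assumes "norm z = 1"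
  shows "norm (1 - cnj a * z) = norm (z - a)"
  using norm_moebius_identity[of a z] assms by simp

lemma one_minus_cnj_mult_nz:
  fixes a z :: complex
  assumes "norm a < 1" "norm z \<le> 1"
  shows "1 - cnj a * z \<noteq> 0"
proof
  assume "1 - cnj a * z = 0"
  then have "norm (cnj a * z) = 1" by (metis eq_iff_diff_eq_0 norm_one)
  moreover have "norm a * norm z < 1" using assms
    by (metis mult_left_le norm_ge_zero order_le_less_trans)
  ultimately show False by (simp add: norm_mult)
qed

text \<open>Each zero \<open>a\<close> in the open disc is traded for the factor
  \<open>1 - cnj a * z\<close>, which has no zero there and the same modulus as \<open>z - a\<close>
  on the circle; the quotients make up \<open>\<beta>\<close>. Zeros on the circle remain in
  \<open>h\<close>, which is therefore zero-free only inside.\<close>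

lemma poly_blaschke_factorization:
  fixes P :: "complex poly"
  assumes "P \<noteq> 0"
  shows "\<exists>\<beta> h. \<beta> holomorphic_on ball 0 1 \<and> (\<forall>z\<in>ball 0 1. norm (\<beta> z) \<le> 1 \<and> poly h z \<noteq> 0 \<and> poly P z = \<beta> z * poly h z) \<and>
           (\<forall>z. norm z = 1 \<longrightarrow> norm (poly h z) = norm (poly P z))"
  using assms
proof (induction "degree P" arbitrary: P)
  case 0
  then obtain c where P: "P = [:c:]" "c \<noteq> 0" by (metis degree_eq_zeroE pCons_eq_0_iff)
  show ?case
    by (rule exI[of _ "\<lambda>_. 1"], rule exI[of _ P]) (use P in auto)
next
  case (Suc n)
  show ?case
  proof (cases "\<exists>a\<in>ball 0 1. poly P a = 0")
    case False
    then show ?thesis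
      by (intro exI[of _ "\<lambda>_. 1"] exI[of _ P]) auto
  next
    case True
    then obtain a where a: "norm a < 1" "poly P a = 0" by auto
    then obtain R where R: "P = [:-a, 1:] * R" by (metis dvdE poly_eq_0_iff_dvd)
    with Suc.prems have "R \<noteq> 0" by auto
    then have "degree P = Suc (degree R)" unfolding R by (subst degree_mult_eq) auto
    with Suc.hyps(2) have "n = degree R" by simp
    from Suc.hyps(1)[OF this \<open>R \<noteq> 0\<close>] obtain \<beta> h where h: "\<beta> holomorphic_on ball 0 1"
        "\<And>z. z \<in> ball 0 1 \<Longrightarrow> norm (\<beta> z) \<le> 1 \<and> poly h z \<noteq> 0 \<and> poly R z = \<beta> z * poly h z"
        "\<And>z. norm z = 1 \<Longrightarrow> norm (poly h z) = norm (poly R z)" by metis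
    have nz: "1 - cnj a * z \<noteq> 0" if "z \<in> ball 0 1" for z
      using one_minus_cnj_mult_nz[of a z] a that by auto
    show ?thesis
    proof (intro exI conjI ballI allI impI)
      show "(\<lambda>z. (z - a) / (1 - cnj a * z) * \<beta> z) holomorphic_on ball 0 1"
        using h(1) nz by (intro holomorphic_intros) auto
    next
      fix z :: complex assume z: "z \<in> ball 0 1"
      have "norm ((z - a) / (1 - cnj a * z)) \<le> 1"
        using norm_moebius_le[of a z] a z nz[OF z] by (simp add: norm_divide divide_le_eq_1)
      then show "norm ((z - a) / (1 - cnj a * z) * \<beta> z) \<le> 1"
        using h(2)[OF z] by (simp only: norm_mult) (simp add: mult_le_one)
      show "poly ([:1, - cnj a:] * h) z \<noteq> 0"
        using h(2)[OF z] nz[OF z] by (simp add: algebra_simps)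
      have "(1 - cnj a * z) * ((z - a) / (1 - cnj a * z)) = z - a" using nz[OF z] by simp
      moreover have "poly ([:1, - cnj a:] * h) z = (1 - cnj a * z) * poly h z" by (simp add: algebra_simps)
      moreover have "poly P z = (z - a) * (\<beta> z * poly h z)" using h(2)[OF z] by (simp add: R algebra_simps)
      ultimately show "poly P z = (z - a) / (1 - cnj a * z) * \<beta> z * poly ([:1, - cnj a:] * h) z"
        by (metis (no_types, lifting) mult.assoc mult.commute)
    next
      fix z :: complex assume z: "norm z = 1"
      have "poly ([:1, - cnj a:] * h) z = (1 - cnj a * z) * poly h z" by (simp add: algebra_simps)
      moreover have "poly P z = (z - a) * poly R z" by (simp add: R algebra_simps)
      ultimately show "norm (poly ([:1, - cnj a:] * h) z) = norm (poly P z)"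
        using h(3)[OF z] norm_moebius_eq[OF z, of a] by (simp add: norm_mult)
    qed
  qed
qed

text \<open>
  Riesz factorisation: a rational function is \<open>(\<beta> k) k\<close> with \<open>\<beta>\<close> a finite Blaschke product and
  \<open>k\<^sup>2\<close> zero-free of the same modulus on the circle, so its \<open>L\<^sup>1\<close> mean
  controls the \<open>H\<^sup>2\<close> norms of both factors.
\<close>
lemma rational_deriv_inner_le:
  fixes P Q :: "complex poly"
  assumes Q: "\<And>z. norm z \<le> 1 \<Longrightarrow> poly Q z \<noteq> 0" and d: "0 < d" "d < 1"
  shows "(\<integral>\<^sup>+z\<in>cball 0 (1-d). ennreal (norm (deriv (\<lambda>z. poly P z / poly Q z) z)) \<partial>lborel) \<le> 
     ennreal (sqrt (ln (1/d)) * integral {0..2*pi} (\<lambda>t. norm (poly P (cis t) / poly Q (cis t))))"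
proof (cases "P = 0")
  case False
  then obtain \<beta> h where h: "\<beta> holomorphic_on ball 0 1"
      "\<And>z. z \<in> ball 0 1 \<Longrightarrow> norm (\<beta> z) \<le> 1 \<and> poly h z \<noteq> 0 \<and> poly P z = \<beta> z * poly h z"
      "\<And>z. norm z = 1 \<Longrightarrow> norm (poly h z) = norm (poly P z)"
    using poly_blaschke_factorization by metis
  define H where "H z = poly h z / poly Q z" for z
  have "H holomorphic_on ball 0 1"
    unfolding H_def using Q by (intro holomorphic_intros) auto
  moreover have "contractible (ball (0::complex) 1)" by (simp add: convex_imp_contractible)
  moreover have "H z \<noteq> 0" if "z \<in> ball 0 1" for z
    using h(2)[OF that] Q[of z] that by (simp add: H_def)
  \<comment> \<open>The square root is needed on the open disc only, so zeros of \<open>H\<close> on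
    the circle do no harm.\<close>
  ultimately obtain k where k: "k holomorphic_on ball 0 1" "\<And>z. z \<in> ball 0 1 \<Longrightarrow> H z = k z ^ 2"
    using contractible_imp_holomorphic_sqrt by metis
  define m where "m = integral {0..2*pi} (\<lambda>t. norm (H (cis t))) / (2*pi)"
  have contH: "continuous_on (cball 0 1) H"
    unfolding H_def using Q by (intro continuous_intros) auto
  have mk: "integral {0..2*pi} (\<lambda>t. (norm (k (of_real r * cis t)))\<^sup>2) \<le> 2 * pi * m" if "0 \<le> r" "r < 1" for r
    using sqrt_mean_le[OF k(1) contH _ that] k(2) by (simp add: m_def)
  have m0: "m \<ge> 0" unfolding m_def by (intro divide_nonneg_pos integral_nonneg integrable_continuous_interval
      continuous_intros continuous_on_compose2[OF contH]) auto
  have int: "(\<lambda>t. (norm (w (of_real r * cis t)))\<^sup>2) integrable_on {0..2*pi}" 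
    if "w holomorphic_on ball 0 1" "0 \<le> r" "r < 1" for w :: "complex \<Rightarrow> complex" and r
    using parseval_taylor(1)[OF that(1), of "of_real r"] that by auto
  have hu: "(\<lambda>z. \<beta> z * k z) holomorphic_on ball 0 1" by (intro holomorphic_intros h k)
  have "integral {0..2*pi} (\<lambda>t. (norm (\<beta> (of_real r * cis t) * k (of_real r * cis t)))\<^sup>2) \<le> 2 * pi * m" if "0 \<le> r" "r < 1" for r
  proof -
    have "integral {0..2*pi} (\<lambda>t. (norm (\<beta> (of_real r * cis t) * k (of_real r * cis t)))\<^sup>2) \<le> 
       integral {0..2*pi} (\<lambda>t. (norm (k (of_real r * cis t)))\<^sup>2)"
    proof (rule integral_le)
      fix t
      have "norm (\<beta> (of_real r * cis t)) \<le> 1" using h(2)[of "of_real r * cis t"] that by (simp add: norm_mult)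
      then show "(norm (\<beta> (of_real r * cis t) * k (of_real r * cis t)))\<^sup>2 \<le> (norm (k (of_real r * cis t)))\<^sup>2"
        by (intro power_mono) (auto simp: norm_mult intro: mult_left_le_one_le)
    qed (use int[OF hu that] int[OF k(1) that] in auto)
    with mk[OF that] show ?thesis by simp
  qed
  moreover have "poly P z / poly Q z = \<beta> z * k z * k z" if "norm z < 1" for z
  proof -
    have "poly P z / poly Q z = \<beta> z * H z" using h(2)[of z] that by (simp add: H_def)
    then show ?thesis using k(2)[of z] that by (simp add: power2_eq_square)
  qed
  ultimately have "(\<integral>\<^sup>+z\<in>cball 0 (1-d). ennreal (norm (deriv (\<lambda>z. poly P z / poly Q z) z)) \<partial>lborel) \<le> 
      ennreal (2 * pi * m * sqrt (ln (1/d)))"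
    by (intro deriv_product_area_le[OF hu k(1)] mk d m0) auto
  \<comment> \<open>On the circle |h| = |P|, so |H| has the mean of the given function.\<close>
  also have "2 * pi * m = integral {0..2*pi} (\<lambda>t. norm (poly P (cis t) / poly Q (cis t)))"
    by (simp add: m_def H_def norm_divide h(3))
  finally show ?thesis by (simp add: mult.commute)
qed simp

section \<open>The reproducing kernel\<close>

text \<open>Cauchy's formula in the angle; the factor \<open>cis t\<close> comes from dw = i w
  dt.\<close>

lemma cauchy_integral_cis:
  assumes cont: "continuous_on (cball 0 1) F" and hol: "F holomorphic_on ball 0 1" and z: "norm z < 1"
  shows "((\<lambda>t. cis t * F (cis t) / (cis t - z) ^ Suc k) has_integral 2 * of_real pi * ((deriv ^^ k) F z / fact k)) {0..2*pi}"
proof -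
  have "((\<lambda>u. F u / (u-z) ^ (Suc k)) has_contour_integral ((2 * pi * \<i>) / (fact k) * (deriv ^^ k) F z))
           (part_circlepath 0 1 0 (2*pi))"
    using Cauchy_has_contour_integral_higher_derivative_circlepath[OF cont hol, of z k] z
    by (simp add: circlepath_def)
  then have "((\<lambda>t. F (0 + of_real 1 * cis t) / (0 + of_real 1 * cis t - z) ^ Suc k * of_real 1 * \<i> * cis t) has_integral
       ((2 * pi * \<i>) / (fact k) * (deriv ^^ k) F z)) {0..2*pi}"
    by (subst (asm) has_contour_integral_part_circlepath_iff) (simp_all del: power_Suc)
  from has_integral_mult_right[OF this, of "- \<i>"] show ?thesis
    by (simp add: mult_ac del: power_Suc)
qed

lemma mean_value_cis:
  assumes cont: "continuous_on (cball 0 1) F" and hol: "F holomorphic_on ball 0 1"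
  shows "((\<lambda>t. F (cis t)) has_integral 2 * of_real pi * F 0) {0..2*pi}"
  using cauchy_integral_cis[OF cont hol, of 0 0] by simp

lemma has_integral_cnj_fun:
  "(f has_integral I) A \<Longrightarrow> ((\<lambda>x. cnj (f x)) has_integral cnj I) A"
  using has_integral_linear[OF _ bounded_linear_cnj, of f I A] by (simp add: o_def)

text \<open>The polarised form of \<open>norm_moebius_identity\<close>. The factor
  \<open>1 - cnj z * w\<close> that it exposes will cancel the singularity of the Cauchy kernel,
  leaving only denominators attached to \<open>a\<close>.\<close>

lemma moebius_kernel_identity:
  fixes a z w :: complex
  assumes "1 - cnj a * z \<noteq> 0" "1 - cnj a * w \<noteq> 0"
  shows "1 - cnj ((z - a) / (1 - cnj a * z)) * ((w - a) / (1 - cnj a * w)) =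
         of_real (1 - (norm a)\<^sup>2) * (1 - cnj z * w) / (cnj (1 - cnj a * z) * (1 - cnj a * w))"
proof -
  have one_minus_divide: "1 - A / n = (n - A) / n" if "n \<noteq> 0" for A n :: complex
    using that by (simp add: diff_divide_distrib)
  have n: "cnj (1 - cnj a * z) * (1 - cnj a * w) \<noteq> 0" using assms by (metis complex_cnj_zero_iff mult_eq_0_iff)
  have "1 - cnj ((z - a) / (1 - cnj a * z)) * ((w - a) / (1 - cnj a * w)) =
      (cnj (1 - cnj a * z) * (1 - cnj a * w) - cnj (z - a) * (w - a)) / (cnj (1 - cnj a * z) * (1 - cnj a * w))"
    unfolding complex_cnj_divide times_divide_times_eq by (rule one_minus_divide[OF n])
  also have "cnj (1 - cnj a * z) * (1 - cnj a * w) - cnj (z - a) * (w - a) = (1 - a * cnj a) * (1 - cnj z * w)"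
    by (simp add: algebra_simps)
  also have "a * cnj a = of_real ((norm a)\<^sup>2)" by (rule complex_norm_square[symmetric])
  finally show ?thesis by simp
qed

text \<open>
  For \<open>g\<close> with denominator degree at least that of the numerator, \<open>cnj g * B\<close> agrees on the unit
  circle with a function analytic in the disc, so in Cauchy's formula for \<open>g'\<close> the kernel
  \<open>w / (1 - cnj z * w)\<^sup>2\<close> may be multiplied by \<open>(1 - cnj (B z) * B w)\<^sup>2\<close>.
\<close>
lemma rational_deriv_kernel_le:
  fixes P :: "complex poly" and l :: "nat \<Rightarrow> complex" and c :: complex and N :: nat
  defines "g \<equiv> \<lambda>w. poly P w / (c * (\<Prod>j<N. 1 - cnj (l j) * w))"
  assumes c: "c \<noteq> 0" and l: "\<And>j. j < N \<Longrightarrow> norm (l j) < 1" and deg: "degree P \<le> N" and z: "norm z < 1"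
  shows "2 * pi * norm (deriv g z) \<le> (\<Sum>j<N. real N * (1 - (norm (l j))\<^sup>2)\<^sup>2 / (norm (1 - cnj (l j) * z))\<^sup>2 *
            integral {0..2*pi} (\<lambda>t. norm (g (cis t)) / (norm (1 - cnj (l j) * cis t))\<^sup>2))"
proof -
  define D where "D w = (\<Prod>j<N. 1 - cnj (l j) * w)" for w
  \<comment> \<open>The poles of \<open>g\<close> lie at points 1 / cnj (l j). Conjugation on the
    circle reflects them to \<open>l j\<close>, where \<open>B\<close> has its zeros.\<close>
  define B where "B w = (\<Prod>j<N. (w - l j) / (1 - cnj (l j) * w))" for w
  define b where "b = B z"
  \<comment> \<open>On the unit circle the conjugate of \<open>H\<close> is the Cauchy kernel w / (w
    - z)^2 of the derivative.\<close>
  define H where "H w = w / (1 - cnj z * w)\<^sup>2" for w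
  \<comment> \<open>Coefficient reversal: on the circle the conjugate of P(w) is R(w) / w^N, with a
    polynomial \<open>R\<close> because \<open>degree P \<le> N\<close>.\<close>
  define R where "R w = (\<Sum>i\<le>N. cnj (coeff P i) * w ^ (N - i))" for w
  define W where "W w = R w / (cnj c * D w)" for w
  have nz: "1 - cnj (l j) * w \<noteq> 0" if "norm w \<le> 1" "j < N" for w j
    using one_minus_cnj_mult_nz[OF l[OF that(2)] that(1)] .
  have Dnz: "D w \<noteq> 0" if "norm w \<le> 1" for w
    unfolding D_def using nz[OF that] by (subst prod_zero_iff) auto
  have Hnz: "1 - cnj z * w \<noteq> 0" if "norm w \<le> 1" for w
    using one_minus_cnj_mult_nz[OF z that] .
  have g_eq: "g w = poly P w / (c * D w)" for w by (simp add: g_def D_def)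
  have g_hol: "g holomorphic_on ball 0 1" and W_hol: "W holomorphic_on ball 0 1" 
    unfolding g_def W_def R_def D_def using c Dnz by (auto simp: D_def intro!: holomorphic_intros)
  have B_hol: "B holomorphic_on ball 0 1"
    unfolding B_def using nz by (intro holomorphic_intros) auto
  have H_hol: "H holomorphic_on ball 0 1"
    unfolding H_def using Hnz by (intro holomorphic_intros) auto
  have g_cont: "continuous_on (cball 0 1) g" and W_cont: "continuous_on (cball 0 1) W"
    unfolding g_def W_def R_def D_def using c Dnz by (auto simp: D_def intro!: continuous_intros)
  have B_cont: "continuous_on (cball 0 1) B"
    unfolding B_def using nz by (intro continuous_intros) auto
  have H_cont: "continuous_on (cball 0 1) H"
    unfolding H_def using Hnz by (intro continuous_intros) auto
  have W: "cnj (g w) * B w = W w" if w: "norm w = 1" for w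
  proof -
    have w0: "w \<noteq> 0" and ww: "cnj w = 1 / w" using w
      by (auto simp: divide_conv_cnj)
    have "poly P w = (\<Sum>i\<le>N. coeff P i * w ^ i)"
      unfolding poly_altdef using deg by (intro sum.mono_neutral_left) (auto intro: coeff_eq_0)
    then have "cnj (poly P w) = (\<Sum>i\<le>N. cnj (coeff P i) * cnj w ^ i)" by simp
    also have "\<dots> = (\<Sum>i\<le>N. (cnj (coeff P i) * w ^ (N - i)) / w ^ N)"
      by (rule sum.cong) (use w0 in \<open>auto simp: ww power_diff field_simps\<close>)
    also have "\<dots> = R w / w ^ N" unfolding R_def by (simp add: sum_divide_distrib)
    finally have 1: "cnj (poly P w) = R w / w ^ N" .
    have "cnj (D w) = (\<Prod>j<N. (w - l j) / w)"
      unfolding D_def cnj_prod by (rule prod.cong) (use w0 in \<open>auto simp: ww field_simps\<close>)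
    then have 2: "cnj (D w) = (\<Prod>j<N. w - l j) / w ^ N" by (simp add: prod_dividef)
    have 3: "B w = (\<Prod>j<N. w - l j) / D w" by (simp add: B_def D_def prod_dividef)
    have "cnj (D w) \<noteq> 0" using Dnz[of w] w by simp
    then have "(\<Prod>j<N. w - l j) \<noteq> 0" using 2 by auto
    then show ?thesis unfolding g_eq W_def using c w0 Dnz[of w] w
      by (simp add: 1 2 3)
  qed
  \<comment> \<open>On the circle |1 - cnj b * B w| is at most a multiple of |1 - cnj z * w|, so a
    square is needed to cancel the squared denominator of \<open>H\<close>.\<close>
  define h where "h w = H w * (1 - cnj b * B w)\<^sup>2" for w
  have I1: "((\<lambda>t. g (cis t) * cnj (H (cis t))) has_integral 2 * of_real pi * deriv g z) {0..2*pi}"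
  proof -
    have "cnj (H (cis t)) = cis t / (cis t - z)^2" for t
    proof -
      have "cis t \<noteq> z" using z by auto
      have "cnj (H (cis t)) = cnj (cis t) / (1 - z * cnj (cis t))^2" by (simp add: H_def)
      also have "cnj (cis t) = 1 / cis t" by (simp add: divide_conv_cnj)
      finally show ?thesis using \<open>cis t \<noteq> z\<close> by (simp add: field_simps power2_eq_square)
    qed
    then show ?thesis
      using cauchy_integral_cis[OF g_cont g_hol z, of 1] by (simp add: mult_ac power2_eq_square)
  qed
  \<comment> \<open>The mean value is the conjugate of W(0) H(0), and H(0) = 0 because of the factor
    \<open>w\<close> in the numerator of \<open>H\<close>. The same factor makes \<open>I3\<close>
    vanish.\<close>
  have I2: "((\<lambda>t. cnj (W (cis t) * H (cis t))) has_integral 0) {0..2*pi}"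
    using has_integral_cnj_fun[OF mean_value_cis[of "\<lambda>w. W w * H w"]] 
    by (simp add: continuous_on_mult W_cont H_cont holomorphic_on_mult W_hol H_hol) (simp add: H_def)
  have I3: "((\<lambda>t. cnj (W (cis t) * B (cis t) * H (cis t))) has_integral 0) {0..2*pi}"
    using has_integral_cnj_fun[OF mean_value_cis[of "\<lambda>w. W w * B w * H w"]] 
    by (simp add: continuous_on_mult W_cont H_cont B_cont holomorphic_on_mult W_hol H_hol B_hol) (simp add: H_def)
  \<comment> \<open>Expanding the square; each term containing a conjugate of \<open>B\<close> is
    rewritten through \<open>W\<close>, and so is the conjugate of an analytic function.\<close>
  have eq: "g w * cnj (h w) = g w * cnj (H w) - 2 * b * cnj (W w * H w) + b^2 * cnj (W w * B w * H w)" 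
    if "norm w = 1" for w
    unfolding h_def W[OF that, symmetric] by (simp add: power2_eq_square algebra_simps)
  have "((\<lambda>t. g (cis t) * cnj (H (cis t)) - 2 * b * cnj (W (cis t) * H (cis t)) + b^2 * cnj (W (cis t) * B (cis t) * H (cis t)))
     has_integral (2 * of_real pi * deriv g z - 2 * b * 0 + b^2 * 0)) {0..2*pi}"
    by (intro has_integral_add has_integral_diff has_integral_mult_right I1 I2 I3)
  then have I: "((\<lambda>t. g (cis t) * cnj (h (cis t))) has_integral (2 * of_real pi * deriv g z)) {0..2*pi}"
    by (simp add: eq)
  have fac: "norm ((w - l j) / (1 - cnj (l j) * w)) \<le> 1" if "norm w \<le> 1" "j < N" for w j
    using norm_moebius_le[of "l j" w] l[OF that(2)] nz[OF that] that by (simp add: norm_divide divide_le_eq_1)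
  have hb: "norm (h w) \<le> (\<Sum>j<N. real N * (1 - (norm (l j))\<^sup>2)\<^sup>2 / (norm (1 - cnj (l j) * z))\<^sup>2 / (norm (1 - cnj (l j) * w))\<^sup>2)"
    if w: "norm w = 1" for w
  proof -
    define x where "x j = (1 - (norm (l j))\<^sup>2) / (norm (1 - cnj (l j) * z) * norm (1 - cnj (l j) * w))" for j
    have "norm (1 - cnj b * B w) = norm ((\<Prod>j<N. 1) - 
        (\<Prod>j<N. cnj ((z - l j) / (1 - cnj (l j) * z)) * ((w - l j) / (1 - cnj (l j) * w))))"
      unfolding b_def B_def cnj_prod prod.distrib by simp
    \<comment> \<open>A product of numbers of modulus at most 1 differs from 1 by at most the sum of
      the single differences. This separates the factors of \<open>B\<close>.\<close>
    also have "\<dots> \<le> (\<Sum>j<N. norm (1 - cnj ((z - l j) / (1 - cnj (l j) * z)) * ((w - l j) / (1 - cnj (l j) * w))))"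
    proof (rule norm_prod_diff)
      fix j assume "j \<in> {..<N}"
      then have "norm ((z - l j) / (1 - cnj (l j) * z)) \<le> 1" "norm ((w - l j) / (1 - cnj (l j) * w)) \<le> 1"
        using z w by (auto intro!: fac)
      then show "norm (cnj ((z - l j) / (1 - cnj (l j) * z)) * ((w - l j) / (1 - cnj (l j) * w))) \<le> 1"
        by (simp only: norm_mult complex_mod_cnj) (simp add: mult_le_one)
    qed simp
    also have "\<dots> = (\<Sum>j<N. norm (1 - cnj z * w) * x j)"
    proof (rule sum.cong[OF refl])
      fix j assume j: "j \<in> {..<N}"
      then have n: "1 - cnj (l j) * z \<noteq> 0" "1 - cnj (l j) * w \<noteq> 0" using nz z w by auto
      have "0 \<le> 1 - (norm (l j))\<^sup>2" using l[of j] j by (simp add: power_le_one)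
      then have "norm (complex_of_real (1 - (norm (l j))\<^sup>2)) = 1 - (norm (l j))\<^sup>2" by (simp only: norm_of_real abs_of_nonneg)
      then show "norm (1 - cnj ((z - l j) / (1 - cnj (l j) * z)) * ((w - l j) / (1 - cnj (l j) * w))) = norm (1 - cnj z * w) * x j"
        unfolding moebius_kernel_identity[OF n] x_def by (simp only: norm_mult norm_divide complex_mod_cnj) simp
    qed
    also have "\<dots> = norm (1 - cnj z * w) * (\<Sum>j<N. x j)" by (simp add: sum_distrib_left)
    finally have le: "norm (1 - cnj b * B w) \<le> norm (1 - cnj z * w) * (\<Sum>j<N. x j)" .
    have "norm (h w) = (norm (1 - cnj b * B w))\<^sup>2 / (norm (1 - cnj z * w))\<^sup>2"
      using w by (simp add: h_def H_def norm_mult norm_divide norm_power)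
    also have "\<dots> \<le> (norm (1 - cnj z * w) * (\<Sum>j<N. x j))\<^sup>2 / (norm (1 - cnj z * w))\<^sup>2"
      using le by (intro divide_right_mono power_mono) auto
    also have "\<dots> = (\<Sum>j<N. x j)\<^sup>2" using Hnz[of w] w by (simp add: power_mult_distrib)
    \<comment> \<open>Cauchy-Schwarz decouples the poles at the price of a factor N.\<close>
    also have "\<dots> \<le> (\<Sum>j<N. (x j)\<^sup>2) * real N"
      using sum_squared_le_sum_of_squares[of x "{..<N}"] by simp
    also have "\<dots> = (\<Sum>j<N. real N * (1 - (norm (l j))\<^sup>2)\<^sup>2 / (norm (1 - cnj (l j) * z))\<^sup>2 / (norm (1 - cnj (l j) * w))\<^sup>2)"
      by (simp add: x_def sum_distrib_left sum_distrib_right power_divide power_mult_distrib mult.commute)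
    finally show ?thesis .
  qed
  have "2 * pi * norm (deriv g z) = norm (integral {0..2*pi} (\<lambda>t. g (cis t) * cnj (h (cis t))))"
    by (simp add: integral_unique[OF I] norm_mult)
  also have "\<dots> \<le> integral {0..2*pi} (\<lambda>t. \<Sum>j<N. real N * (1 - (norm (l j))\<^sup>2)\<^sup>2 / (norm (1 - cnj (l j) * z))\<^sup>2 *
            (norm (g (cis t)) / (norm (1 - cnj (l j) * cis t))\<^sup>2))"
  proof (rule integral_norm_bound_integral)
    show "(\<lambda>t. g (cis t) * cnj (h (cis t))) integrable_on {0..2*pi}" using I by blast
    show "(\<lambda>t. \<Sum>j<N. real N * (1 - (norm (l j))\<^sup>2)\<^sup>2 / (norm (1 - cnj (l j) * z))\<^sup>2 *
            (norm (g (cis t)) / (norm (1 - cnj (l j) * cis t))\<^sup>2)) integrable_on {0..2*pi}"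
      using nz[of "cis _"]
      by (intro integrable_continuous_interval continuous_intros continuous_on_compose2[OF g_cont]) auto
    fix t
    have "norm (g (cis t) * cnj (h (cis t))) = norm (g (cis t)) * norm (h (cis t))" by (simp add: norm_mult)
    also have "\<dots> \<le> norm (g (cis t)) * (\<Sum>j<N. real N * (1 - (norm (l j))\<^sup>2)\<^sup>2 / (norm (1 - cnj (l j) * z))\<^sup>2 / (norm (1 - cnj (l j) * cis t))\<^sup>2)"
      by (intro mult_left_mono hb) auto
    also have "\<dots> = (\<Sum>j<N. real N * (1 - (norm (l j))\<^sup>2)\<^sup>2 / (norm (1 - cnj (l j) * z))\<^sup>2 *
            (norm (g (cis t)) / (norm (1 - cnj (l j) * cis t))\<^sup>2))"
      by (simp add: sum_distrib_left mult_ac)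
    finally show "norm (g (cis t) * cnj (h (cis t))) \<le> (\<Sum>j<N. real N * (1 - (norm (l j))\<^sup>2)\<^sup>2 / (norm (1 - cnj (l j) * z))\<^sup>2 *
            (norm (g (cis t)) / (norm (1 - cnj (l j) * cis t))\<^sup>2))" .
  qed
  also have "\<dots> = (\<Sum>j<N. real N * (1 - (norm (l j))\<^sup>2)\<^sup>2 / (norm (1 - cnj (l j) * z))\<^sup>2 *
            integral {0..2*pi} (\<lambda>t. norm (g (cis t)) / (norm (1 - cnj (l j) * cis t))\<^sup>2))"
  proof -
    have "(\<lambda>t. norm (g (cis t)) / (norm (1 - cnj (l j) * cis t))\<^sup>2) integrable_on {0..2*pi}" if "j < N" for j
      using nz[of "cis _", OF _ that]
      by (intro integrable_continuous_interval continuous_intros continuous_on_compose2[OF g_cont]) auto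
    then show ?thesis
      using integral_sum[of "{..<N}" "\<lambda>j t. real N * (1 - (norm (l j))\<^sup>2)\<^sup>2 / (norm (1 - cnj (l j) * z))\<^sup>2 *
            (norm (g (cis t)) / (norm (1 - cnj (l j) * cis t))\<^sup>2)" "{0..2*pi}"]
      by (simp only: integral_mult_right integrable_on_mult_right lessThan_iff finite_lessThan)
  qed
  finally show ?thesis .
qed

section \<open>The outer annulus\<close>

text \<open>Parseval for the geometric series of 1 / (1 - a w).\<close>

lemma has_integral_inverse_square_pole:
  fixes a :: complex
  assumes a: "norm a < 1"
  shows "((\<lambda>t. 1 / (norm (1 - a * cis t))\<^sup>2) has_integral 2 * pi / (1 - (norm a)\<^sup>2)) {0..2*pi}"
proof -
  have "summable (\<lambda>n. norm (a ^ n))" using a by (simp add: norm_power summable_geometric)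
  from parseval(1)[OF this]
  have "((\<lambda>t. (norm (\<Sum>n. a ^ n * cis t ^ n))\<^sup>2) has_integral 2 * pi * (\<Sum>n. (norm (a ^ n))\<^sup>2)) {0..2*pi}" .
  moreover have "(\<Sum>n. a ^ n * cis t ^ n) = 1 / (1 - a * cis t)" for t
    using a by (simp add: power_mult_distrib[symmetric] suminf_geometric norm_mult)
  moreover have "(\<Sum>n. (norm (a ^ n))\<^sup>2) = 1 / (1 - (norm a)\<^sup>2)"
  proof -
    have "(norm (a ^ n))\<^sup>2 = ((norm a)\<^sup>2) ^ n" for n
      by (simp add: norm_power power_mult[symmetric] mult.commute)
    moreover have "norm ((norm a)\<^sup>2) < 1" using a by (simp add: power_less_one_iff abs_square_less_1)
    ultimately show ?thesis by (simp add: suminf_geometric)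
  qed
  ultimately show ?thesis by (simp add: norm_divide power_divide)
qed

lemma norm_one_minus_ge:
  fixes a z :: complex
  assumes "norm z \<le> 1"
  shows "1 - norm a \<le> norm (1 - a * z)"
proof -
  have "norm (a * z) \<le> norm a" using assms by (simp add: norm_mult mult_left_le)
  moreover have "1 - norm (a * z) \<le> norm (1 - a * z)" using norm_triangle_ineq2[of 1 "a * z"] by simp
  ultimately show ?thesis by simp
qed

text \<open>Hoelder's inequality with exponents 1/(1-s) and q = 1/s. With d = 1 - |a|, the weight |1
  - a w|^(-2) is at most d^(-2) and has mean at most 1/d, so the mean of its q-th power is at most
  d^(1-2q) and its q-norm at most d^(s-2), which is \<open>\<Phi>\<close> in the proof.\<close>

lemma hoelder_pole_le:
  fixes g :: "complex \<Rightarrow> complex"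
  assumes a: "norm a < 1" and s: "0 < s" "s < 1" and G: "G > 0"
    and cont: "continuous_on (cball 0 1) g"
    and mean: "integral {0..2*pi} (\<lambda>t. norm (g (cis t)) powr (1/(1-s))) \<le> 2 * pi * G powr (1/(1-s))"
  shows "integral {0..2*pi} (\<lambda>t. norm (g (cis t)) / (norm (1 - a * cis t))\<^sup>2) \<le> 2 * pi * (G * (1 - norm a) powr (s - 2))"
proof -
  define d where "d = 1 - norm a"
  define p where "p = 1 / (1 - s)"
  define q where "q = 1 / s"
  define \<Phi> where "\<Phi> = d powr (s - 2)"
  define w where "w t = 1 / (norm (1 - a * cis t))\<^sup>2" for t
  have d: "0 < d" "d \<le> 1" using a by (auto simp: d_def)
  have pq: "p > 1" "q > 1" "1/p + 1/q = 1" using s by (auto simp: p_def q_def field_simps)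
  have \<Phi>: "\<Phi> > 0" using d by (simp add: \<Phi>_def)
  have \<rho>: "d \<le> norm (1 - a * cis t)" for t
    using norm_one_minus_ge[of "cis t" a] by (simp add: d_def)
  have \<rho>0: "norm (1 - a * cis t) > 0" for t using \<rho>[of t] d by linarith
  have w0: "w t \<ge> 0" for t by (simp add: w_def)
  have wd: "w t * d^2 \<le> 1" for t
  proof -
    have "d^2 \<le> (norm (1 - a * cis t))\<^sup>2" using \<rho>[of t] d by (intro power_mono) auto
    moreover have "(norm (1 - a * cis t))\<^sup>2 > 0" using \<rho>0[of t] by (rule zero_less_power)
    ultimately show ?thesis by (simp add: w_def divide_le_eq_1)
  qed
  \<comment> \<open>Pointwise form of the q-norm bound: \<open>w t * d^2\<close> is at most 1, so
    its q-th power is no larger than itself, and the remaining factor is d^(-s q) = 1/d.\<close>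
  have yq: "(w t / \<Phi>) powr q \<le> d * w t" for t
  proof -
    have "w t / \<Phi> = w t * d^2 * d powr (- s)"
      using d by (simp add: \<Phi>_def powr_diff powr_minus field_simps)
    then have "(w t / \<Phi>) powr q = (w t * d^2) powr q * (d powr (- s)) powr q"
      using w0 d by (simp add: powr_mult)
    also have "(d powr (- s)) powr q = 1 / d"
    proof -
      have "- s * q = - 1" using s by (simp add: q_def)
      then show ?thesis using d by (simp only: powr_powr) (simp add: powr_neg_one)
    qed
    also have "(w t * d^2) powr q \<le> (w t * d^2) powr 1"
      using wd[of t] w0[of t] pq by (intro powr_mono') auto
    then have "(w t * d^2) powr q * (1 / d) \<le> (w t * d^2) powr 1 * (1 / d)"
      using d by (intro mult_right_mono) auto
    also have "(w t * d^2) powr 1 = w t * d^2" using w0[of t] by simp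
    finally show ?thesis using d by (simp add: power2_eq_square mult_ac)
  qed
  have pt: "norm (g (cis t)) * w t \<le> G * \<Phi> * ((norm (g (cis t)) powr p / G powr p) / p + d * w t / q)" for t
  proof -
    have "(norm (g (cis t)) / G) * (w t / \<Phi>) \<le> (norm (g (cis t)) / G) powr p / p + (w t / \<Phi>) powr q / q"
      using pq G \<Phi> w0 by (intro Youngs_inequality) auto
    also have "\<dots> \<le> (norm (g (cis t)) powr p / G powr p) / p + d * w t / q"
      using yq[of t] pq G by (intro add_mono divide_right_mono) (auto simp: powr_divide)
    finally show ?thesis using G \<Phi> by (simp add: field_simps)
  qed
  have cw: "continuous_on {0..2*pi} w"
    unfolding w_def using \<rho>0 by (intro continuous_intros ballI) (metis less_irrefl power_eq_0_iff)
  have cg: "continuous_on {0..2*pi} (\<lambda>t. norm (g (cis t)))"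
    by (intro continuous_intros continuous_on_compose2[OF cont]) auto
  have cgp: "continuous_on {0..2*pi} (\<lambda>t. norm (g (cis t)) powr p)"
    using pq by (intro continuous_on_powr' cg continuous_intros) auto
  have Iw: "integral {0..2*pi} w \<le> 2 * pi / d"
  proof -
    have "integral {0..2*pi} w = 2 * pi / (1 - (norm a)\<^sup>2)"
      unfolding w_def by (rule integral_unique[OF has_integral_inverse_square_pole[OF a]])
    also have "\<dots> \<le> 2 * pi / d"
    proof -
      have "(norm a)\<^sup>2 \<le> norm a" using a by (simp add: power2_eq_square mult_left_le)
      then have "d \<le> 1 - (norm a)\<^sup>2" by (simp add: d_def)
      with d show ?thesis by (intro divide_left_mono) auto
    qed
    finally show ?thesis .
  qed
  have "integral {0..2*pi} (\<lambda>t. norm (g (cis t)) * w t) \<le> 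
     integral {0..2*pi} (\<lambda>t. G * \<Phi> * ((norm (g (cis t)) powr p / G powr p) / p + d * w t / q))"
    using G pq by (intro integral_le pt integrable_continuous_interval continuous_intros cw cg cgp) auto
  also have "\<dots> = G * \<Phi> * (integral {0..2*pi} (\<lambda>t. norm (g (cis t)) powr p) / G powr p / p + d * integral {0..2*pi} w / q)"
  proof -
    have "((\<lambda>t. G * \<Phi> * ((norm (g (cis t)) powr p / G powr p) / p + d * w t / q)) has_integral 
       G * \<Phi> * (integral {0..2*pi} (\<lambda>t. norm (g (cis t)) powr p) / G powr p / p + d * integral {0..2*pi} w / q)) {0..2*pi}"
      by (intro has_integral_mult_right has_integral_add has_integral_divide
           integrable_integral integrable_continuous_interval cw cgp)
    then show ?thesis by (rule integral_unique)
  qed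
  also have "\<dots> \<le> G * \<Phi> * (2 * pi / p + 2 * pi / q)"
  proof -
    have "integral {0..2*pi} (\<lambda>t. norm (g (cis t)) powr p) / G powr p \<le> 2 * pi"
      using mean G by (simp add: p_def divide_le_eq)
    moreover have "d * integral {0..2*pi} w \<le> 2 * pi" using Iw d by (simp add: field_simps)
    ultimately show ?thesis using G \<Phi> pq by (intro mult_left_mono add_mono divide_right_mono) auto
  qed
  also have "\<dots> = 2 * pi * (G * \<Phi>)"
  proof -
    have "2 * pi / p + 2 * pi / q = 2 * pi * (1 / p + 1 / q)" by (simp add: distrib_left)
    then show ?thesis using pq(3) by simp
  qed
  finally show ?thesis by (simp add: w_def \<Phi>_def d_def)
qed

text \<open>The circle mean is (1-|a|)^s / (1-|az|^2). Since 1 - |a| and 1 - |z| are both at most 1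
  - |az|, it is bounded by (1-|z|)^(s-1), uniformly in \<open>a\<close>; this is integrable up to
  the circle because s > 0.\<close>

lemma pole_annulus_area_le:
  fixes a :: complex
  assumes a: "norm a < 1" and s: "0 < s" "s < 1" and d: "0 < d" "d \<le> 1"
  shows "(\<integral>\<^sup>+z\<in>ball 0 1. ennreal ((1 - norm a) powr s / (norm (1 - a * z))\<^sup>2) * indicator {1-d<..} (norm z) \<partial>lborel)
          \<le> ennreal (2 * pi * (d powr s / s))"
proof -
  define \<phi> :: "real \<Rightarrow> ennreal" where "\<phi> r = ennreal ((1 - r) powr (s - 1)) * indicator {1-d<..} r" for r
  have [measurable]: "\<phi> \<in> borel_measurable borel" unfolding \<phi>_def[abs_def] by measurable
  have "(\<integral>\<^sup>+z\<in>ball 0 1. ennreal ((1 - norm a) powr s / (norm (1 - a * z))\<^sup>2) * indicator {1-d<..} (norm z) \<partial>lborel)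
      \<le> (\<integral>\<^sup>+r\<in>{0..1}. ennreal (2*pi*r) * \<phi> r \<partial>lborel)"
  proof (rule nn_integral_disc_le)
    fix z :: complex assume z: "norm z < 1"
    have az: "norm (a * z) < 1" using a z
      by (metis norm_mult mult_left_le norm_ge_zero order_le_less_trans less_imp_le)
    have "norm a * norm z \<le> norm a" "norm a * norm z \<le> norm z" using a z by (auto simp: mult_left_le mult_left_le_one_le)
    then have le: "1 - norm a \<le> 1 - norm (a * z)" "1 - norm z \<le> 1 - norm (a * z)" by (auto simp: norm_mult)
    have "((\<lambda>t. (1 - norm a) powr s * (1 / (norm (1 - a * z * cis t))\<^sup>2)) has_integral
         (1 - norm a) powr s * (2 * pi / (1 - (norm (a * z))\<^sup>2))) {0..2*pi}"
      by (intro has_integral_mult_right has_integral_inverse_square_pole az)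
    then have "((\<lambda>t. (1 - norm a) powr s / (norm (1 - a * (z * cis t)))\<^sup>2) has_integral
         2 * pi * ((1 - norm a) powr s / (1 - (norm (a * z))\<^sup>2))) {0..2*pi}"
      by (simp add: mult_ac)
    then have "(\<integral>\<^sup>+t\<in>{0..2*pi}. ennreal ((1 - norm a) powr s / (norm (1 - a * (z * cis t)))\<^sup>2) \<partial>lborel)
       = ennreal (2 * pi * ((1 - norm a) powr s / (1 - (norm (a * z))\<^sup>2)))"
      by (rule nn_integral_circle) simp
    also have "\<dots> \<le> ennreal (2 * pi * (1 - norm z) powr (s - 1))"
    proof (intro ennreal_leI mult_left_mono)
      have "(norm (a * z))\<^sup>2 \<le> norm (a * z)" using az by (simp add: power2_eq_square mult_left_le)
      then have "(1 - norm a) powr s / (1 - (norm (a * z))\<^sup>2) \<le> (1 - norm (a * z)) powr s / (1 - norm (a * z))"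
        using le a az s by (intro frac_le powr_mono2) auto
      also have "\<dots> = (1 - norm (a * z)) powr (s - 1)" using az by (simp add: powr_diff)
      also have "\<dots> \<le> (1 - norm z) powr (s - 1)" using le z s by (intro powr_mono2') auto
      finally show "(1 - norm a) powr s / (1 - (norm (a * z))\<^sup>2) \<le> (1 - norm z) powr (s - 1)" .
    qed simp
    finally have main: "(\<integral>\<^sup>+t\<in>{0..2*pi}. ennreal ((1 - norm a) powr s / (norm (1 - a * (z * cis t)))\<^sup>2) \<partial>lborel) 
        \<le> ennreal (2*pi) * ennreal ((1 - norm z) powr (s - 1))" by (simp add: ennreal_mult')
    show "(\<integral>\<^sup>+t\<in>{0..2*pi}. ennreal ((1 - norm a) powr s / (norm (1 - a * (z * cis t)))\<^sup>2) * indicator {1-d<..} (norm (z * cis t)) \<partial>lborel)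
       \<le> ennreal (2*pi) * \<phi> (norm z)"
      using main by (cases "norm z > 1 - d") (simp_all add: norm_mult \<phi>_def)
  qed measurable
  also have "\<dots> \<le> (\<integral>\<^sup>+r. ennreal (indicator {1-d..1} r * (2*pi* (1 - r) powr (s - 1))) \<partial>lborel)"
  proof (rule nn_integral_mono)
    fix r :: real
    have "2*pi*r*(1-r) powr (s-1) \<le> 2*pi*1*(1 - r) powr (s - 1)" if "r \<in> {0..1}"
      using that by (intro mult_right_mono mult_left_mono) auto
    then show "ennreal (2*pi*r) * \<phi> r * indicator {0..1} r \<le> ennreal (indicator {1-d..1} r * (2*pi* (1 - r) powr (s - 1)))"
      using d by (auto simp: \<phi>_def indicator_def ennreal_mult'[symmetric] intro!: ennreal_leI)
  qed
  also have "\<dots> = ennreal (2 * pi * (- ((1-1) powr s / s) - - ((1-(1-d)) powr s / s)))"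
  proof (rule nn_integral_has_integral_lebesgue)
    show "((\<lambda>r. 2 * pi * (1 - r) powr (s - 1)) has_integral 2 * pi * (- ((1-1) powr s / s) - - ((1-(1-d)) powr s / s))) {1-d..1}"
    \<comment> \<open>The integrand is unbounded near 1, but its antiderivative is continuous there,
      so derivatives in the interior suffice.\<close>
    proof (intro has_integral_mult_right fundamental_theorem_of_calculus_interior)
      show "continuous_on {1-d..1} (\<lambda>r. - ((1-r) powr s / s))"
        using s by (intro continuous_intros continuous_on_powr') auto
      fix r assume "r \<in> {1-d<..<1}"
      then have "((\<lambda>r. - ((1-r) powr s / s)) has_real_derivative (1 - r) powr (s - 1)) (at r)"
        using s by (auto intro!: derivative_eq_intros simp: powr_diff field_simps)
      then show "((\<lambda>r. - ((1-r) powr s / s)) has_vector_derivative (1 - r) powr (s - 1)) (at r)"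
        by (simp add: has_real_derivative_iff_has_vector_derivative)
    qed (use d in auto)
  qed auto
  finally show ?thesis by simp
qed

text \<open>A root \<open>w\<close> outside the closed disc contributes -w (1 - z/w), with
  \<open>l j = 1 / cnj w\<close> its reflection in the circle. Missing factors are padded with
  \<open>l j = 0\<close>, so \<open>N\<close> can bound the degrees of numerator and denominator at
  once.\<close>

lemma poly_pole_factorization:
  fixes Q :: "complex poly"
  assumes "\<And>z. norm z \<le> 1 \<Longrightarrow> poly Q z \<noteq> 0" "degree Q \<le> N"
  shows "\<exists>c l. c \<noteq> 0 \<and> (\<forall>j<N. norm (l j :: complex) < 1) \<and> (\<forall>z. poly Q z = c * (\<Prod>j<N. 1 - cnj (l j) * z))"
  using assms
proof (induction N arbitrary: Q)
  case 0
  then obtain c where "Q = [:c:]" by (metis degree_eq_zeroE le_zero_eq)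
  with 0(1)[of 0] show ?case by (intro exI[of _ c]) auto
next
  case (Suc N)
  show ?case
  proof (cases "degree Q \<le> N")
    case True
    with Suc.IH[of Q] Suc.prems obtain c l where l: "c \<noteq> 0" "\<And>j. j < N \<Longrightarrow> norm (l j :: complex) < 1" 
        "\<And>z. poly Q z = c * (\<Prod>j<N. 1 - cnj (l j) * z)" by blast
    show ?thesis
      by (rule exI[of _ c], rule exI[of _ "l(N := 0)"]) (use l in \<open>auto simp: less_Suc_eq\<close>)
  next
    case False
    then have "\<not> constant (poly Q)" using constant_degree[of Q] by simp
    then obtain w where w: "poly Q w = 0" using fundamental_theorem_of_algebra by blast
    with Suc.prems(1)[of w] have w1: "norm w > 1" by force
    then have w0: "w \<noteq> 0" by auto
    from w obtain R where R: "Q = [:-w, 1:] * R" by (metis dvdE poly_eq_0_iff_dvd)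
    with Suc.prems(1)[of 0] have "R \<noteq> 0" by auto
    then have "degree Q = Suc (degree R)" unfolding R by (subst degree_mult_eq) auto
    with Suc.prems(2) have "degree R \<le> N" by simp
    moreover have "poly R z \<noteq> 0" if "norm z \<le> 1" for z using Suc.prems(1)[OF that] R by auto
    ultimately obtain c l where l: "c \<noteq> 0" "\<And>j. j < N \<Longrightarrow> norm (l j :: complex) < 1" 
        "\<And>z. poly R z = c * (\<Prod>j<N. 1 - cnj (l j) * z)" using Suc.IH[of R] by blast
    show ?thesis
    proof (intro exI conjI allI impI)
      show "- w * c \<noteq> 0" using w0 l by simp
      show "norm ((l(N := 1 / cnj w)) j) < 1" if "j < Suc N" for j
        using that l(2)[of j] w1 by (auto simp: less_Suc_eq norm_divide divide_less_eq)
      show "poly Q z = - w * c * (\<Prod>j<Suc N. 1 - cnj ((l(N := 1 / cnj w)) j) * z)" for z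
        using w0 by (simp add: R l(3) field_simps)
    qed
  qed
qed

text \<open>With e = 1 - |l j|, the kernel contributes e^2 and Hoelder's inequality e^(s-2); the
  product e^s is the numerator in \<open>pole_annulus_area_le\<close>. Of the two factors N, one is
  in the kernel bound and one counts the poles.\<close>

lemma rational_deriv_outer_le:
  fixes P Q :: "complex poly"
  assumes Q: "\<And>z. norm z \<le> 1 \<Longrightarrow> poly Q z \<noteq> 0" and deg: "degree P \<le> N" "degree Q \<le> N"
    and s: "0 < s" "s < 1" and d: "0 < d" "d \<le> 1" and G: "G > 0"
    and mean: "integral {0..2*pi} (\<lambda>t. norm (poly P (cis t) / poly Q (cis t)) powr (1/(1-s))) \<le> 2 * pi * G powr (1/(1-s))"
  shows "(\<integral>\<^sup>+z\<in>ball 0 1. ennreal (norm (deriv (\<lambda>z. poly P z / poly Q z) z)) * indicator {1-d<..} (norm z) \<partial>lborel)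
     \<le> ennreal (8 * pi * (real N)\<^sup>2 * G * d powr s / s)"
proof -
  obtain c l where c: "c \<noteq> 0" and l: "\<And>j. j < N \<Longrightarrow> norm (l j :: complex) < 1"
    and Q_eq: "\<And>z. poly Q z = c * (\<Prod>j<N. 1 - cnj (l j) * z)"
    using poly_pole_factorization[OF Q deg(2)] by blast
  define g where "g w = poly P w / (c * (\<Prod>j<N. 1 - cnj (l j) * w))" for w
  have g: "(\<lambda>z. poly P z / poly Q z) = g" by (auto simp: g_def Q_eq)
  have g_cont: "continuous_on (cball 0 1) g"
    unfolding g[symmetric] using Q by (intro continuous_intros) auto
  have mean': "integral {0..2*pi} (\<lambda>t. norm (g (cis t)) powr (1/(1-s))) \<le> 2 * pi * G powr (1/(1-s))"
    using mean by (simp add: g[symmetric])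
  have pt: "norm (deriv g z) \<le> (\<Sum>j<N. 4 * N * G * ((1 - norm (l j)) powr s / (norm (1 - cnj (l j) * z))\<^sup>2))"
    if z: "norm z < 1" for z
  proof -
    have "2 * pi * norm (deriv g z) \<le> (\<Sum>j<N. real N * (1 - (norm (l j))\<^sup>2)\<^sup>2 / (norm (1 - cnj (l j) * z))\<^sup>2 *
            integral {0..2*pi} (\<lambda>t. norm (g (cis t)) / (norm (1 - cnj (l j) * cis t))\<^sup>2))"
      unfolding g_def[abs_def] by (rule rational_deriv_kernel_le[OF c l deg(1) z])
    also have "\<dots> \<le> (\<Sum>j<N. 2 * pi * (4 * N * G * ((1 - norm (l j)) powr s / (norm (1 - cnj (l j) * z))\<^sup>2)))"
    proof (rule sum_mono)
      fix j assume "j \<in> {..<N}"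
      then have lj: "norm (l j) < 1" using l by simp
      define e where "e = 1 - norm (l j)"
      have e: "0 < e" "e \<le> 1" using lj by (auto simp: e_def)
      have "integral {0..2*pi} (\<lambda>t. norm (g (cis t)) / (norm (1 - cnj (l j) * cis t))\<^sup>2) \<le> 2 * pi * (G * e powr (s - 2))"
        using hoelder_pole_le[OF _ s G g_cont mean', of "cnj (l j)"] lj by (simp add: e_def)
      moreover have "(1 - (norm (l j))\<^sup>2)\<^sup>2 \<le> 4 * e^2"
      proof -
        have "1 - (norm (l j))\<^sup>2 = e * (1 + norm (l j))" by (simp add: e_def power2_eq_square algebra_simps)
        also have "\<dots> \<le> e * 2" using e lj by (intro mult_left_mono) auto
        finally have "1 - (norm (l j))\<^sup>2 \<le> 2 * e" by simp
        moreover have "0 \<le> 1 - (norm (l j))\<^sup>2" using lj by (simp add: power_le_one)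
        ultimately have "(1 - (norm (l j))\<^sup>2)\<^sup>2 \<le> (2 * e)\<^sup>2" by (rule power_mono)
        then show ?thesis by (simp add: power_mult_distrib)
      qed
      ultimately have "real N * (1 - (norm (l j))\<^sup>2)\<^sup>2 / (norm (1 - cnj (l j) * z))\<^sup>2 *
            integral {0..2*pi} (\<lambda>t. norm (g (cis t)) / (norm (1 - cnj (l j) * cis t))\<^sup>2) \<le>
          real N * (1 - (norm (l j))\<^sup>2)\<^sup>2 / (norm (1 - cnj (l j) * z))\<^sup>2 * (2 * pi * (G * e powr (s - 2)))"
          and "real N * (1 - (norm (l j))\<^sup>2)\<^sup>2 / (norm (1 - cnj (l j) * z))\<^sup>2 * (2 * pi * (G * e powr (s - 2))) \<le>
          real N * (4 * e^2) / (norm (1 - cnj (l j) * z))\<^sup>2 * (2 * pi * (G * e powr (s - 2)))"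
        using G by (intro mult_left_mono mult_right_mono divide_right_mono; simp)+
      then have "real N * (1 - (norm (l j))\<^sup>2)\<^sup>2 / (norm (1 - cnj (l j) * z))\<^sup>2 *
            integral {0..2*pi} (\<lambda>t. norm (g (cis t)) / (norm (1 - cnj (l j) * cis t))\<^sup>2) \<le>
          real N * (4 * e^2) / (norm (1 - cnj (l j) * z))\<^sup>2 * (2 * pi * (G * e powr (s - 2)))"
        by (rule order_trans)
      also have "\<dots> = 2 * pi * (4 * N * G * ((e^2 * e powr (s - 2)) / (norm (1 - cnj (l j) * z))\<^sup>2))"
        by (simp add: field_simps)
      also have "e^2 * e powr (s - 2) = e powr s"
        using e by (simp add: powr_diff)
      finally show "real N * (1 - (norm (l j))\<^sup>2)\<^sup>2 / (norm (1 - cnj (l j) * z))\<^sup>2 *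
            integral {0..2*pi} (\<lambda>t. norm (g (cis t)) / (norm (1 - cnj (l j) * cis t))\<^sup>2) \<le>
           2 * pi * (4 * N * G * ((1 - norm (l j)) powr s / (norm (1 - cnj (l j) * z))\<^sup>2))"
        by (simp add: e_def)
    qed
    also have "\<dots> = 2 * pi * (\<Sum>j<N. 4 * N * G * ((1 - norm (l j)) powr s / (norm (1 - cnj (l j) * z))\<^sup>2))"
      by (simp only: sum_distrib_left)
    finally show ?thesis by simp
  qed
  define F where "F j z = ennreal ((1 - norm (l j)) powr s / (norm (1 - cnj (l j) * z))\<^sup>2) * indicator {1-d<..} (norm z) * indicator (ball 0 1) z" for j z
  have [measurable]: "ball (0::complex) 1 \<in> sets borel" by simp
  have [measurable]: "F j \<in> borel_measurable borel" for j
    unfolding F_def[abs_def] by measurable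
  have "(\<integral>\<^sup>+z\<in>ball 0 1. ennreal (norm (deriv g z)) * indicator {1-d<..} (norm z) \<partial>lborel) \<le>
     (\<integral>\<^sup>+z. (\<Sum>j<N. ennreal (4 * N * G) * F j z) \<partial>lborel)"
  proof (rule nn_integral_mono)
    fix z :: complex
    show "ennreal (norm (deriv g z)) * indicator {1-d<..} (norm z) * indicator (ball 0 1) z \<le> (\<Sum>j<N. ennreal (4 * N * G) * F j z)"
    proof (cases "z \<in> ball 0 1 \<and> norm z > 1 - d")
      case True
      have "ennreal (norm (deriv g z)) \<le> ennreal (\<Sum>j<N. 4 * N * G * ((1 - norm (l j)) powr s / (norm (1 - cnj (l j) * z))\<^sup>2))"
        using True by (intro ennreal_leI pt) auto
      also have "\<dots> = (\<Sum>j<N. ennreal (4 * N * G * ((1 - norm (l j)) powr s / (norm (1 - cnj (l j) * z))\<^sup>2)))"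
        using G by (intro sum_ennreal[symmetric]) auto
      also have "\<dots> = (\<Sum>j<N. ennreal (4 * N * G) * F j z)"
      proof (rule sum.cong[OF refl])
        fix j
        have F: "F j z = ennreal ((1 - norm (l j)) powr s / (norm (1 - cnj (l j) * z))\<^sup>2)"
          using True by (simp add: F_def)
        show "ennreal (4 * N * G * ((1 - norm (l j)) powr s / (norm (1 - cnj (l j) * z))\<^sup>2)) = ennreal (4 * N * G) * F j z"
          unfolding F using G by (intro ennreal_mult') simp
      qed
      finally show ?thesis using True by simp
    qed (auto simp: indicator_def)
  qed
  also have "\<dots> = (\<Sum>j<N. ennreal (4 * N * G) * integral\<^sup>N lborel (F j))"
    by (subst nn_integral_sum) (auto simp: nn_integral_cmult)
  also have "\<dots> \<le> (\<Sum>j<N. ennreal (4 * N * G) * ennreal (2 * pi * (d powr s / s)))"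
  proof (intro sum_mono mult_left_mono)
    fix j assume "j \<in> {..<N}"
    then show "integral\<^sup>N lborel (F j) \<le> ennreal (2 * pi * (d powr s / s))"
      using pole_annulus_area_le[OF _ s d, of "cnj (l j)"] l[of j] by (simp add: F_def[abs_def])
  qed auto
  also have "\<dots> = ennreal (8 * pi * (real N)\<^sup>2 * G * d powr s / s)"
    using G s by (simp add: ennreal_mult'[symmetric] ennreal_of_nat_eq_real_of_nat power2_eq_square mult_ac)
  finally show ?thesis by (simp add: g)
qed

text \<open>In place of Jensen's inequality: x \<le> 1 + x^p at x = \<open>\<phi> t / G\<close>,
  which loses only a factor 2.\<close>

lemma integral_le_of_integral_powr:
  fixes \<phi> :: "real \<Rightarrow> real"
  assumes p: "p > 1" and nn: "\<And>t. \<phi> t \<ge> 0" and G: "G > 0" and cont: "continuous_on {0..2*pi} \<phi>"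
    and mean: "integral {0..2*pi} (\<lambda>t. \<phi> t powr p) \<le> 2 * pi * G powr p"
  shows "integral {0..2*pi} \<phi> \<le> 4 * pi * G"
proof -
  have cp: "continuous_on {0..2*pi} (\<lambda>t. \<phi> t powr p)"
    using p nn by (intro continuous_on_powr' cont continuous_intros) auto
  have int: "((\<lambda>t. G * (1 + \<phi> t powr p / G powr p)) has_integral 
      G * ((2*pi) * 1 + integral {0..2*pi} (\<lambda>t. \<phi> t powr p) / G powr p)) {0..2*pi}"
    using has_integral_const_real[of "1::real" 0 "2*pi"]
    by (intro has_integral_mult_right has_integral_add has_integral_divide
         integrable_integral integrable_continuous_interval cp) auto
  have "integral {0..2*pi} \<phi> \<le> integral {0..2*pi} (\<lambda>t. G * (1 + \<phi> t powr p / G powr p))"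
  proof (rule integral_le)
    show "\<phi> integrable_on {0..2*pi}" by (intro integrable_continuous_interval cont)
    show "(\<lambda>t. G * (1 + \<phi> t powr p / G powr p)) integrable_on {0..2*pi}" using int by blast
    fix t
    have "x \<le> 1 + x powr p" if "x \<ge> 0" for x :: real
      using p that powr_mono[of 1 p x] by (cases "x \<le> 1") (auto intro: add_increasing2)
    from this[of "\<phi> t / G"] G nn[of t]
    show "\<phi> t \<le> G * (1 + \<phi> t powr p / G powr p)"
      by (simp add: powr_divide divide_le_eq mult.commute)
  qed
  also have "\<dots> = G * ((2*pi) * 1 + integral {0..2*pi} (\<lambda>t. \<phi> t powr p) / G powr p)"
    by (rule integral_unique[OF int])
  also have "\<dots> \<le> G * (2*pi + 2*pi)"
    using mean G by (intro mult_left_mono add_mono) (auto simp: divide_le_eq)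
  finally show ?thesis by (simp add: mult_ac)
qed

section \<open>The Bernstein inequality for rational functions\<close>

definition bernstein_const :: "real \<Rightarrow> real" where
  "bernstein_const s = 4 * pi * sqrt (2 / s) + 16 * pi / s"

text \<open>The first summand of \<open>bernstein_const\<close> is the inner disc, where ln (1/d) =
  (2/s) ln N and the L^1 mean is at most 4 pi G. The second is the annulus: its bound 8 pi G / s
  carries no logarithm and is multiplied by 2 sqrt (ln N), which is at least 1 because
  \<open>N \<ge> 2\<close>.\<close>

lemma rational_deriv_area_le:
  fixes P Q :: "complex poly"
  assumes Q: "\<And>z. norm z \<le> 1 \<Longrightarrow> poly Q z \<noteq> 0" and deg: "degree P \<le> N" "degree Q \<le> N" and N: "N \<ge> 2"
    and s: "0 < s" "s < 1" and G: "G > 0"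
    and mean: "integral {0..2*pi} (\<lambda>t. norm (poly P (cis t) / poly Q (cis t)) powr (1/(1-s))) \<le> 2 * pi * G powr (1/(1-s))"
  shows "(\<integral>\<^sup>+z\<in>ball 0 1. ennreal (norm (deriv (\<lambda>z. poly P z / poly Q z) z)) \<partial>lborel)
     \<le> ennreal (bernstein_const s * sqrt (ln (real N)) * G)"
proof -
  define g where "g z = poly P z / poly Q z" for z
  define d where "d = real N powr (- 2 / s)"
  have N1: "real N > 1" using N by simp
  have d: "0 < d" "d < 1" using N1 s by (auto simp: d_def powr_less_one)
  have g_cont: "continuous_on (cball 0 1) g"
    unfolding g_def using Q by (intro continuous_intros) auto
  have g_hol: "g holomorphic_on ball 0 1"
    unfolding g_def using Q by (intro holomorphic_intros) auto
  then have "deriv g holomorphic_on ball 0 1" by (rule holomorphic_deriv) simp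
  from borel_measurable_on_disc[OF this]
  obtain H where H[measurable]: "H \<in> borel_measurable borel" "H = (\<lambda>z. indicator (ball 0 1) z *\<^sub>R deriv g z)"
    by blast
  have [measurable]: "cball (0::complex) (1-d) \<in> sets borel" by simp
  have ln2: "1 / 4 \<le> ln (2::real)" using ln_2_less_1 ln2_ge_two_thirds by linarith
  have L: "1 \<le> 2 * sqrt (ln (real N))"
  proof -
    have "ln 2 \<le> ln (real N)" using N by (subst ln_le_cancel_iff) auto
    then have "1 / 4 \<le> ln (real N)" using ln2 by linarith
    then have "sqrt (1/4) \<le> sqrt (ln (real N))" by simp
    then show ?thesis by (simp add: real_sqrt_divide)
  qed
  have "(\<integral>\<^sup>+z\<in>ball 0 1. ennreal (norm (deriv g z)) \<partial>lborel) =
      (\<integral>\<^sup>+z. ennreal (norm (H z)) * indicator (cball 0 (1-d)) z + ennreal (norm (H z)) * indicator {1-d<..} (norm z) \<partial>lborel)"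
    by (intro nn_integral_cong) (auto simp: H(2) indicator_def)
  also have "\<dots> = (\<integral>\<^sup>+z. ennreal (norm (H z)) * indicator (cball 0 (1-d)) z \<partial>lborel) + 
      (\<integral>\<^sup>+z. ennreal (norm (H z)) * indicator {1-d<..} (norm z) \<partial>lborel)"
    by (rule nn_integral_add) measurable
  also have "(\<integral>\<^sup>+z. ennreal (norm (H z)) * indicator (cball 0 (1-d)) z \<partial>lborel) = 
     (\<integral>\<^sup>+z\<in>cball 0 (1-d). ennreal (norm (deriv g z)) \<partial>lborel)"
    using d by (intro nn_integral_cong) (auto simp: H(2) indicator_def)
  also have "\<dots> \<le> ennreal (sqrt (ln (1/d)) * integral {0..2*pi} (\<lambda>t. norm (g (cis t))))"
    unfolding g_def by (rule rational_deriv_inner_le[OF Q d])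
  also have "\<dots> \<le> ennreal (4 * pi * sqrt (2 / s) * sqrt (ln (real N)) * G)"
  proof (rule ennreal_leI)
    have "ln (1/d) = 2 / s * ln (real N)" using N1 by (simp add: d_def ln_div ln_powr)
    then have 1: "sqrt (ln (1/d)) = sqrt (2 / s) * sqrt (ln (real N))" by (simp only: real_sqrt_mult)
    have "continuous_on {0..2*pi} (\<lambda>t. norm (g (cis t)))"
      by (intro continuous_intros continuous_on_compose2[OF g_cont]) auto
    then have 2: "integral {0..2*pi} (\<lambda>t. norm (g (cis t))) \<le> 4 * pi * G"
      by (intro integral_le_of_integral_powr[of "1 / (1 - s)"]) (use mean s G in \<open>auto simp: g_def\<close>)
    have "sqrt (ln (1/d)) * integral {0..2*pi} (\<lambda>t. norm (g (cis t))) \<le> sqrt (2 / s) * sqrt (ln (real N)) * (4 * pi * G)"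
      unfolding 1 using 2 N1 s by (intro mult_left_mono) auto
    then show "sqrt (ln (1/d)) * integral {0..2*pi} (\<lambda>t. norm (g (cis t))) \<le> 4 * pi * sqrt (2 / s) * sqrt (ln (real N)) * G"
      by (simp add: mult_ac)
  qed
  also have "(\<integral>\<^sup>+z. ennreal (norm (H z)) * indicator {1-d<..} (norm z) \<partial>lborel) =
     (\<integral>\<^sup>+z\<in>ball 0 1. ennreal (norm (deriv g z)) * indicator {1-d<..} (norm z) \<partial>lborel)"
    by (intro nn_integral_cong) (auto simp: H(2) indicator_def)
  also have "\<dots> \<le> ennreal (8 * pi * (real N)\<^sup>2 * G * d powr s / s)"
    unfolding g_def[abs_def] using d by (intro rational_deriv_outer_le[OF Q deg s _ _ G mean]) auto
  also have "8 * pi * (real N)\<^sup>2 * G * d powr s / s = 8 * pi * G / s"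
  proof -
    have "d powr s = real N powr (- 2)" using s by (simp add: d_def powr_powr)
    also have "\<dots> = 1 / (real N)\<^sup>2" using N1 by (simp add: powr_minus_divide)
    finally show ?thesis using N1 by simp
  qed
  also have "ennreal (8 * pi * G / s) \<le> ennreal (16 * pi / s * sqrt (ln (real N)) * G)"
  proof (rule ennreal_leI)
    have "8 * pi * G / s * 1 \<le> 8 * pi * G / s * (2 * sqrt (ln (real N)))"
      using L G s by (intro mult_left_mono) auto
    then show "8 * pi * G / s \<le> 16 * pi / s * sqrt (ln (real N)) * G" by (simp add: mult_ac)
  qed
  also have "ennreal (4 * pi * sqrt (2 / s) * sqrt (ln (real N)) * G) + ennreal (16 * pi / s * sqrt (ln (real N)) * G)
      = ennreal (bernstein_const s * sqrt (ln (real N)) * G)"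
    using s G N1 by (subst ennreal_plus[symmetric]) (auto simp: bernstein_const_def algebra_simps)
  finally show ?thesis
    by (simp add: g_def[abs_def] add_mono)
qed

section \<open>Rational approximation and the Bergman space\<close>

text \<open>The Bernstein inequality asks for means on the unit circle, whereas distances to
  \<open>f\<close> are known for radii below 1 only. A difference of two approximants is continuous
  on the closed disc, so its bound passes to the limit.\<close>

lemma integral_powr_circle_limit:
  fixes D :: "complex \<Rightarrow> complex"
  assumes p: "p > 1" and cont: "continuous_on (cball 0 1) D"
    and le: "\<And>r. 0 \<le> r \<Longrightarrow> r < 1 \<Longrightarrow> integral {0..2*pi} (\<lambda>t. norm (D (of_real r * cis t)) powr p) \<le> C"
  shows "integral {0..2*pi} (\<lambda>t. norm (D (cis t)) powr p) \<le> C"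
proof -
  define s where "s n = 1 - 1 / real (Suc n)" for n
  have s: "0 \<le> s n" "s n < 1" for n by (auto simp: s_def field_simps)
  have "compact (D ` cball 0 1)" using cont by (intro compact_continuous_image) auto
  then obtain B where B: "\<And>z. norm z \<le> 1 \<Longrightarrow> norm (D z) \<le> B"
    using compact_imp_bounded bounded_iff[of "D ` cball 0 1"] by (metis imageI mem_cball_0)
  have "(\<lambda>n. integral {0..2*pi} (\<lambda>t. norm (D (of_real (s n) * cis t)) powr p)) \<longlonglongrightarrow> integral {0..2*pi} (\<lambda>t. norm (D (cis t)) powr p)"
  proof (rule dominated_convergence(2))
    show "(\<lambda>t. norm (D (of_real (s n) * cis t)) powr p) integrable_on {0..2*pi}" for n
      using s[of n] p
      by (intro integrable_continuous_interval continuous_on_powr' continuous_intros continuous_on_compose2[OF cont]) (auto simp: norm_mult)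
    show "(\<lambda>t. B powr p) integrable_on {0..2*pi}" by (rule integrable_const_ivl)
    show "norm (norm (D (of_real (s n) * cis t)) powr p) \<le> B powr p" for n t
      using s[of n] p by (auto intro!: B powr_mono2 simp: norm_mult)
    have "s \<longlonglongrightarrow> 1 - 0" unfolding s_def 
      by (intro tendsto_diff tendsto_const LIMSEQ_Suc[OF lim_const_over_n])
    then have "(\<lambda>n. of_real (s n) * cis t) \<longlonglongrightarrow> of_real (1 - 0) * cis t" for t
      by (intro tendsto_intros)
    then have "(\<lambda>n. norm (D (of_real (s n) * cis t))) \<longlonglongrightarrow> norm (D (cis t))" for t
      using s by (intro tendsto_norm continuous_on_tendsto_compose[OF cont]) (auto simp: norm_mult less_imp_le intro!: always_eventually)
    then show "(\<lambda>n. norm (D (of_real (s n) * cis t)) powr p) \<longlonglongrightarrow> norm (D (cis t)) powr p" for t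
      using p by (intro tendsto_powr' tendsto_const) auto
  qed
  then show ?thesis by (rule LIMSEQ_le_const2) (use le s in auto)
qed

text \<open>Cauchy's estimate on the circle of radius \<open>r\<close>, dilated to the unit circle.
  For fixed \<open>z\<close> and \<open>r\<close> it is linear in \<open>a\<close>, so approximation
  in mean yields pointwise convergence of the derivatives.\<close>

lemma norm_deriv_le_of_mean:
  fixes h :: "complex \<Rightarrow> complex"
  assumes hol: "h holomorphic_on ball 0 1" and p: "p > 1" and a: "a > 0" and z: "norm z < r" and r: "r < 1"
    and mean: "integral {0..2*pi} (\<lambda>t. norm (h (of_real r * cis t)) powr p) \<le> 2 * pi * a powr p"
  shows "norm (deriv h z) \<le> 2 * a / (r * (1 - norm z / r)\<^sup>2)"
proof -
  have r0: "r > 0" using z norm_ge_zero[of z] by linarith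
  define F where "F w = h (of_real r * w)" for w
  define w where "w = z / of_real r"
  have w: "norm w < 1" using z r0 by (simp add: w_def norm_divide)
  have rb: "of_real r * u \<in> ball 0 1" if "norm u \<le> 1" for u :: complex
  proof -
    have "r * norm u \<le> r * 1" using that r0 by (intro mult_left_mono) auto
    then have "r * norm u < 1" using r by linarith
    then show ?thesis using r0 by (simp add: norm_mult)
  qed
  have F_hol: "F holomorphic_on ball 0 1"
    unfolding F_def by (rule holomorphic_on_compose_gen[OF _ hol, unfolded o_def]) (use rb in \<open>auto intro!: holomorphic_intros\<close>)
  have F_cont: "continuous_on (cball 0 1) F"
    unfolding F_def using rb
    by (intro continuous_on_compose2[OF holomorphic_on_imp_continuous_on[OF hol]] continuous_intros) auto
  have cF: "continuous_on {0..2*pi} (\<lambda>t. norm (F (cis t)))"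
    by (intro continuous_intros continuous_on_compose2[OF F_cont]) auto
  have "((\<lambda>u. of_real r * u) has_field_derivative of_real r) (at w)"
    by (auto intro!: derivative_eq_intros)
  moreover have "(h has_field_derivative deriv h z) (at (of_real r * w))"
    using hol z r r0 by (auto simp: w_def intro!: holomorphic_derivI[of _ "ball 0 1"])
  ultimately have "(F has_field_derivative (deriv h z * of_real r)) (at w)"
    unfolding F_def by (intro DERIV_chain2)
  then have dF: "deriv F w = deriv h z * of_real r" by (rule DERIV_imp_deriv)
  have I: "((\<lambda>t. cis t * F (cis t) / (cis t - w) ^ 2) has_integral 2 * of_real pi * deriv F w) {0..2*pi}"
    using cauchy_integral_cis[OF F_cont F_hol w, of 1] by (simp add: numeral_2_eq_2)
  have "norm (integral {0..2*pi} (\<lambda>t. cis t * F (cis t) / (cis t - w) ^ 2)) \<le> 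
     integral {0..2*pi} (\<lambda>t. norm (F (cis t)) * (1 / (1 - norm w)\<^sup>2))"
  proof (rule integral_norm_bound_integral)
    show "(\<lambda>t. cis t * F (cis t) / (cis t - w)\<^sup>2) integrable_on {0..2*pi}" using I by blast
    show "(\<lambda>t. norm (F (cis t)) * (1 / (1 - norm w)\<^sup>2)) integrable_on {0..2*pi}"
      by (intro integrable_continuous_interval continuous_on_mult cF continuous_on_const)
    fix t
    have "1 - norm w \<le> norm (cis t - w)" using norm_triangle_ineq2[of "cis t" w] by simp
    then have le: "(1 - norm w)\<^sup>2 \<le> (norm (cis t - w))\<^sup>2" using w by (intro power_mono) auto
    have pos: "(1 - norm w)\<^sup>2 > 0" using w by simp
    have "norm (F (cis t)) / (norm (cis t - w))\<^sup>2 \<le> norm (F (cis t)) / (1 - norm w)\<^sup>2"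
      by (rule divide_left_mono[OF le _ mult_pos_pos[OF less_le_trans[OF pos le] pos]]) simp
    then show "norm (cis t * F (cis t) / (cis t - w)\<^sup>2) \<le> norm (F (cis t)) * (1 / (1 - norm w)\<^sup>2)"
      by (simp add: norm_mult norm_divide norm_power)
  qed
  also have "integral {0..2*pi} (\<lambda>t. norm (F (cis t)) * (1 / (1 - norm w)\<^sup>2)) = integral {0..2*pi} (\<lambda>t. norm (F (cis t))) * (1 / (1 - norm w)\<^sup>2)"
    by (rule integral_mult_left)
  also have "\<dots> \<le> (4 * pi * a) * (1 / (1 - norm w)\<^sup>2)"
    using mean by (intro mult_right_mono integral_le_of_integral_powr[OF p _ a cF]) (auto simp: F_def)
  finally have "2 * pi * (norm (deriv h z) * r) \<le> 2 * pi * (2 * a / (1 - norm w)\<^sup>2)"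
    using r0 by (simp add: integral_unique[OF I] dF norm_mult)
  then have "norm (deriv h z) * r \<le> 2 * a / (1 - norm w)\<^sup>2" by (rule mult_left_le_imp_le) simp
  then have "norm (deriv h z) \<le> 2 * a / (1 - norm w)\<^sup>2 / r" using r0 by (simp only: pos_le_divide_eq)
  then show ?thesis using r0 by (simp add: w_def norm_divide mult.commute)
qed

lemma powr_norm_diff_le:
  fixes x y :: "'a :: real_normed_vector"
  assumes p: "p > 1"
  shows "norm (x - y) powr p \<le> 2 powr p * (norm x powr p + norm y powr p)"
proof -
  have "norm (x - y) \<le> 2 * max (norm x) (norm y)"
    using norm_triangle_ineq4[of x y] by linarith
  then have "norm (x - y) powr p \<le> (2 * max (norm x) (norm y)) powr p" using p by (intro powr_mono2) auto
  also have "\<dots> = 2 powr p * (max (norm x) (norm y)) powr p" by (rule powr_mult)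
  also have "\<dots> \<le> 2 powr p * (norm x powr p + norm y powr p)"
    by (intro mult_left_mono) (auto simp: max_def)
  finally show ?thesis .
qed

text \<open>Bernstein's inequality is applied to \<open>g (Suc k) - g k\<close>, whose degree is at
  most M k + M (Suc k); hence this sum in the hypothesis. The series bounds the area integrals of
  all |g k'| uniformly, and Fatou's lemma carries the bound over to f'.\<close>

lemma bergman_of_rational_approx:
  fixes f :: "complex \<Rightarrow> complex" and P Q :: "nat \<Rightarrow> complex poly" and a :: "nat \<Rightarrow> real" and M :: "nat \<Rightarrow> nat"
  defines "g \<equiv> \<lambda>k z. poly (P k) z / poly (Q k) z"
  assumes hol: "f holomorphic_on ball 0 1" and p: "p > 1"
    and a: "\<And>k. a k > 0" "\<And>k. a (Suc k) \<le> a k"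
    and Q: "\<And>k z. norm z \<le> 1 \<Longrightarrow> poly (Q k) z \<noteq> 0"
    and deg: "\<And>k. degree (P k) \<le> M k" "\<And>k. degree (Q k) \<le> M k" "\<And>k. M k \<ge> 1"
    and app: "\<And>k r. 0 \<le> r \<Longrightarrow> r < 1 \<Longrightarrow> 
        integral {0..2*pi} (\<lambda>t. norm (f (of_real r * cis t) - g k (of_real r * cis t)) powr p) \<le> 2 * pi * a k powr p"
    and sm: "summable (\<lambda>k. sqrt (ln (real (M k + M (Suc k)))) * a k)"
  shows "(\<integral>\<^sup>+z\<in>ball 0 1. ennreal (norm (deriv f z)) \<partial>lborel) < \<infinity>"
proof -
  define s where "s = 1 - 1 / p"
  have s: "0 < s" "s < 1" and ps: "1 / (1 - s) = p" using p by (auto simp: s_def field_simps)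
  define c where "c = bernstein_const s"
  have c: "c > 0" unfolding c_def bernstein_const_def using s by (intro add_nonneg_pos) auto
  define w where "w k = sqrt (ln (real (M k + M (Suc k))))" for k
  have M2: "M k + M (Suc k) \<ge> 2" for k using deg(3)[of k] deg(3)[of "Suc k"] by simp
  have w: "1 \<le> 2 * w k" for k
  proof -
    have "1 / 4 \<le> ln (2::real)" using ln2_ge_two_thirds by linarith
    also have "ln 2 \<le> ln (real (M k + M (Suc k)))" using M2[of k] by (subst ln_le_cancel_iff) auto
    finally have "sqrt (1/4) \<le> w k" unfolding w_def by simp
    then show ?thesis by (simp add: real_sqrt_divide)
  qed
  have g_cont: "continuous_on (cball 0 1) (g k)" for k
    unfolding g_def using Q by (intro continuous_intros) auto
  have g_hol: "g k holomorphic_on ball 0 1" for k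
    unfolding g_def using Q by (intro holomorphic_intros) auto
  have dg_hol: "deriv (g k) holomorphic_on ball 0 1" for k
    using g_hol by (rule holomorphic_deriv) simp
  define H where "H k z = indicator (ball 0 1) z *\<^sub>R deriv (g k) z" for k z
  have [measurable]: "H k \<in> borel_measurable borel" for k
    unfolding H_def by (rule borel_measurable_on_disc[OF dg_hol])
  \<comment> \<open>The weights \<open>w k\<close> are at least 1/2, so summability forces
    this.\<close>
  have a0: "a \<longlonglongrightarrow> 0"
  proof (rule tendsto_sandwich[where f="\<lambda>_. 0" and h="\<lambda>k. 2 * (w k * a k)"])
    show "(\<lambda>k. 2 * (w k * a k)) \<longlonglongrightarrow> 0"
      using summable_LIMSEQ_zero[OF sm] by (auto simp: w_def intro!: tendsto_eq_intros)
    have "1 * a k \<le> 2 * w k * a k" for k using a(1)[of k] by (intro mult_right_mono w) auto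
    then show "\<forall>\<^sub>F k in sequentially. a k \<le> 2 * (w k * a k)" by (simp add: mult.assoc)
    show "\<forall>\<^sub>F k in sequentially. 0 \<le> a k" using a(1) by (simp add: less_imp_le)
  qed simp
  have step: "(\<integral>\<^sup>+z. ennreal (norm (H (Suc k) z - H k z)) \<partial>lborel) \<le> ennreal (4 * c * (w k * a k))" for k
  proof -
    define P' where "P' = P (Suc k) * Q k - P k * Q (Suc k)"
    define Q' where "Q' = Q k * Q (Suc k)"
    have Q': "poly Q' z \<noteq> 0" if "norm z \<le> 1" for z using Q[OF that] by (simp add: Q'_def)
    have eq: "poly P' z / poly Q' z = g (Suc k) z - g k z" if "norm z \<le> 1" for z
      using Q[OF that, of k] Q[OF that, of "Suc k"] by (simp add: P'_def Q'_def g_def field_simps)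
    have "degree (P (Suc k) * Q k) \<le> M k + M (Suc k)" "degree (P k * Q (Suc k)) \<le> M k + M (Suc k)"
      by (rule order_trans[OF degree_mult_le]; use deg[of k] deg[of "Suc k"] in linarith)+
    then have degP: "degree P' \<le> M k + M (Suc k)" unfolding P'_def by (rule degree_diff_le)
    have degQ: "degree Q' \<le> M k + M (Suc k)" unfolding Q'_def
      by (rule order_trans[OF degree_mult_le]; use deg[of k] deg[of "Suc k"] in linarith)
    have cont': "continuous_on (cball 0 1) (\<lambda>z. poly P' z / poly Q' z)"
      using Q' by (intro continuous_intros) auto
    have cfg: "continuous_on {0..2*pi} (\<lambda>t. norm (f (of_real r * cis t) - g j (of_real r * cis t)) powr p)" if "0 \<le> r" "r < 1" for r j
      using that p
      by (intro continuous_on_powr' continuous_intros continuous_on_compose2[OF holomorphic_on_imp_continuous_on[OF hol]]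
            continuous_on_compose2[OF g_cont]) (auto simp: norm_mult)
    \<comment> \<open>\<open>f\<close> cancels in (f - g k) - (f - g (Suc k)). In the constant 4,
      one factor 2 comes from \<open>powr_norm_diff_le\<close>, the other absorbs the two summands
      through 2 \<le> 2 powr p.\<close>
    have mean_r: "integral {0..2*pi} (\<lambda>t. norm (poly P' (of_real r * cis t) / poly Q' (of_real r * cis t)) powr p) \<le> 2 * pi * (4 * a k) powr p"
      if r: "0 \<le> r" "r < 1" for r
    proof -
      have "integral {0..2*pi} (\<lambda>t. norm (poly P' (of_real r * cis t) / poly Q' (of_real r * cis t)) powr p) \<le>
         integral {0..2*pi} (\<lambda>t. 2 powr p * (norm (f (of_real r * cis t) - g k (of_real r * cis t)) powr p + 
             norm (f (of_real r * cis t) - g (Suc k) (of_real r * cis t)) powr p))"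
      proof (rule integral_le)
        show "(\<lambda>t. norm (poly P' (of_real r * cis t) / poly Q' (of_real r * cis t)) powr p) integrable_on {0..2*pi}"
          using r p by (intro integrable_continuous_interval continuous_on_powr' continuous_on_norm
            continuous_on_compose2[OF cont'] continuous_intros) (auto simp: norm_mult)
        show "(\<lambda>t. 2 powr p * (norm (f (of_real r * cis t) - g k (of_real r * cis t)) powr p + 
             norm (f (of_real r * cis t) - g (Suc k) (of_real r * cis t)) powr p)) integrable_on {0..2*pi}"
          by (intro integrable_continuous_interval continuous_on_mult continuous_on_add continuous_on_const cfg r)
        fix t
        have n: "norm (of_real r * cis t) \<le> 1" using r by (simp add: norm_mult)
        show "norm (poly P' (of_real r * cis t) / poly Q' (of_real r * cis t)) powr p \<le> 2 powr p * (norm (f (of_real r * cis t) - g k (of_real r * cis t)) powr p + 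
             norm (f (of_real r * cis t) - g (Suc k) (of_real r * cis t)) powr p)"
          unfolding eq[OF n]
          using powr_norm_diff_le[OF p, of "f (of_real r * cis t) - g k (of_real r * cis t)" "f (of_real r * cis t) - g (Suc k) (of_real r * cis t)"]
          by simp
      qed
      also have "\<dots> = 2 powr p * (integral {0..2*pi} (\<lambda>t. norm (f (of_real r * cis t) - g k (of_real r * cis t)) powr p) +
           integral {0..2*pi} (\<lambda>t. norm (f (of_real r * cis t) - g (Suc k) (of_real r * cis t)) powr p))"
        by (subst integral_mult_right, subst Henstock_Kurzweil_Integration.integral_add)
           (auto intro!: integrable_continuous_interval cfg r)
      also have "\<dots> \<le> 2 powr p * (2 * pi * a k powr p + 2 * pi * a (Suc k) powr p)"
        by (intro mult_left_mono add_mono app r) auto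
      also have "\<dots> \<le> 2 powr p * (2 * pi * a k powr p + 2 * pi * a k powr p)"
        using a(1)[of "Suc k"] a(2)[of k] p by (intro mult_left_mono add_mono powr_mono2) auto
      also have "\<dots> = 2 * pi * (2 * (2 powr p * a k powr p))" by simp
      also have "\<dots> \<le> 2 * pi * (2 powr p * (2 powr p * a k powr p))"
        using powr_mono[of 1 p 2] p by (intro mult_left_mono mult_right_mono) auto
      also have "2 powr p * (2 powr p * a k powr p) = (4 * a k) powr p"
      proof -
        have "4 * a k = 2 * (2 * a k)" by simp
        then show ?thesis using a(1)[of k] by (simp only: powr_mult)
      qed
      finally show ?thesis .
    qed
    have mean: "integral {0..2*pi} (\<lambda>t. norm (poly P' (cis t) / poly Q' (cis t)) powr (1/(1-s))) \<le> 2 * pi * (4 * a k) powr (1/(1-s))"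
      unfolding ps by (rule integral_powr_circle_limit[OF p cont' mean_r])
    have "(\<integral>\<^sup>+z. ennreal (norm (H (Suc k) z - H k z)) \<partial>lborel) = 
        (\<integral>\<^sup>+z\<in>ball 0 1. ennreal (norm (deriv (\<lambda>z. poly P' z / poly Q' z) z)) \<partial>lborel)"
    proof (rule nn_integral_cong)
      fix z :: complex
      show "ennreal (norm (H (Suc k) z - H k z)) = ennreal (norm (deriv (\<lambda>z. poly P' z / poly Q' z) z)) * indicator (ball 0 1) z"
      proof (cases "z \<in> ball 0 1")
        case True
        have "((\<lambda>z. g (Suc k) z - g k z) has_field_derivative (deriv (g (Suc k)) z - deriv (g k) z)) (at z)"
          by (intro DERIV_diff holomorphic_derivI[OF g_hol _ True]) auto
        then have "((\<lambda>z. poly P' z / poly Q' z) has_field_derivative (deriv (g (Suc k)) z - deriv (g k) z)) (at z)"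
          by (rule has_field_derivative_transform_within_open[of _ _ _ "ball 0 1"]) (use True eq in auto)
        then show ?thesis using True by (simp add: H_def DERIV_imp_deriv)
      qed (simp add: H_def)
    qed
    also have "\<dots> \<le> ennreal (c * sqrt (ln (real (M k + M (Suc k)))) * (4 * a k))"
      unfolding c_def using a(1)[of k]
      by (intro rational_deriv_area_le[OF Q' degP degQ M2 s _ mean]) auto
    also have "c * sqrt (ln (real (M k + M (Suc k)))) * (4 * a k) = 4 * c * (w k * a k)" by (simp add: w_def mult_ac)
    finally show ?thesis .
  qed
  \<comment> \<open>The telescoping starts at \<open>g 0\<close>, treated by the Bernstein
    inequality with its maximum on the closed disc as \<open>G\<close>. \<open>M 0\<close> may be 1,
    below the required 2, so the degree bound taken is \<open>M 0 + M (Suc 0)\<close>.\<close>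
  obtain C0 where C0: "C0 \<ge> 0" "(\<integral>\<^sup>+z. ennreal (norm (H 0 z)) \<partial>lborel) \<le> ennreal C0"
  proof -
    have "compact (g 0 ` cball 0 1)" using g_cont by (intro compact_continuous_image) auto
    then obtain B where B: "\<And>z. norm z \<le> 1 \<Longrightarrow> norm (g 0 z) \<le> B" "B > 0"
      using compact_imp_bounded bounded_pos[of "g 0 ` cball 0 1"] by (metis imageI mem_cball_0)
    have "integral {0..2*pi} (\<lambda>t. norm (g 0 (cis t)) powr p) \<le> integral {0..2*pi} (\<lambda>t. B powr p)"
      using p by (intro integral_le powr_mono2 B integrable_continuous_interval continuous_on_powr' continuous_intros 
          continuous_on_compose2[OF g_cont]) auto
    then have mean: "integral {0..2*pi} (\<lambda>t. norm (poly (P 0) (cis t) / poly (Q 0) (cis t)) powr (1/(1-s))) \<le> 2 * pi * B powr (1/(1-s))"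
      by (simp add: ps g_def)
    have "(\<integral>\<^sup>+z. ennreal (norm (H 0 z)) \<partial>lborel) = (\<integral>\<^sup>+z\<in>ball 0 1. ennreal (norm (deriv (g 0) z)) \<partial>lborel)"
      by (intro nn_integral_cong) (auto simp: H_def indicator_def)
    also have "\<dots> \<le> ennreal (bernstein_const s * sqrt (ln (real (M 0 + M (Suc 0)))) * B)"
      unfolding g_def using deg[of 0] M2[of 0] by (intro rational_deriv_area_le[OF Q _ _ _ s B(2) mean]) auto
    also have "\<dots> = ennreal (c * w 0 * B)" by (simp add: c_def w_def)
    finally show ?thesis using that[of "c * w 0 * B"] c w[of 0] B(2) by simp
  qed
  have bound: "(\<integral>\<^sup>+z. ennreal (norm (H k z)) \<partial>lborel) \<le> ennreal (C0 + (\<Sum>j<k. 4 * c * (w j * a j)))" for k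
  proof (induction k)
    case 0
    then show ?case using C0 by simp
  next
    case (Suc k)
    have nn: "0 \<le> 4 * c * (w j * a j)" for j using c w[of j] a(1)[of j] by simp
    have "(\<integral>\<^sup>+z. ennreal (norm (H (Suc k) z)) \<partial>lborel) \<le> (\<integral>\<^sup>+z. ennreal (norm (H k z)) + ennreal (norm (H (Suc k) z - H k z)) \<partial>lborel)"
      by (intro nn_integral_mono) (auto simp: ennreal_plus[symmetric] norm_triangle_sub simp del: ennreal_plus intro!: ennreal_leI)
    also have "\<dots> = (\<integral>\<^sup>+z. ennreal (norm (H k z)) \<partial>lborel) + (\<integral>\<^sup>+z. ennreal (norm (H (Suc k) z - H k z)) \<partial>lborel)"
      by (rule nn_integral_add) measurable
    also have "\<dots> \<le> ennreal (C0 + (\<Sum>j<k. 4 * c * (w j * a j))) + ennreal (4 * c * (w k * a k))"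
      by (intro add_mono Suc.IH step)
    also have "\<dots> = ennreal (C0 + (\<Sum>j<Suc k. 4 * c * (w j * a j)))"
      using C0(1) nn by (subst ennreal_plus[symmetric]) (auto intro!: add_nonneg_nonneg sum_nonneg simp: add.assoc)
    finally show ?case .
  qed
  define C where "C = C0 + (\<Sum>j. 4 * c * (w j * a j))"
  have sm': "summable (\<lambda>j. 4 * c * (w j * a j))" using sm by (intro summable_mult) (simp add: w_def)
  have bound': "(\<integral>\<^sup>+z. ennreal (norm (H k z)) \<partial>lborel) \<le> ennreal C" for k
  proof -
    have "0 \<le> 4 * c * (w j * a j)" for j using c w[of j] a(1)[of j] by simp
    then have "(\<Sum>j<k. 4 * c * (w j * a j)) \<le> (\<Sum>j. 4 * c * (w j * a j))"
      using sm' by (intro sum_le_suminf) auto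
    then show ?thesis unfolding C_def by (intro order_trans[OF bound] ennreal_leI) simp
  qed
  have lim: "(\<lambda>k. ennreal (norm (H k z))) \<longlonglongrightarrow> ennreal (norm (deriv f z)) * indicator (ball 0 1) z" for z
  proof (cases "z \<in> ball 0 1")
    case True
    define r where "r = (1 + norm z) / 2"
    have r: "norm z < r" "r < 1" using True by (auto simp: r_def)
    have r0: "r \<ge> 0" using r norm_ge_zero[of z] by linarith
    define K where "K = r * (1 - norm z / r)\<^sup>2"
    have "norm (deriv (g k) z - deriv f z) \<le> 2 * a k / K" for k
    proof -
      have "(\<lambda>z. f z - g k z) holomorphic_on ball 0 1" by (intro holomorphic_intros hol g_hol)
      then have "norm (deriv (\<lambda>z. f z - g k z) z) \<le> 2 * a k / K"
        unfolding K_def by (rule norm_deriv_le_of_mean[OF _ p a(1) r app[OF r0 r(2)]])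
      moreover have "deriv (\<lambda>z. f z - g k z) z = deriv f z - deriv (g k) z"
        by (intro DERIV_imp_deriv DERIV_diff holomorphic_derivI[OF g_hol _ True] holomorphic_derivI[OF hol _ True]) auto
      ultimately show ?thesis by (simp add: norm_minus_commute)
    qed
    moreover have "(\<lambda>k. 2 * a k / K) \<longlonglongrightarrow> 0" using a0 by (auto intro!: tendsto_eq_intros simp: divide_inverse)
    ultimately have "(\<lambda>k. deriv (g k) z - deriv f z) \<longlonglongrightarrow> 0"
      by (intro Lim_null_comparison[of "\<lambda>k. deriv (g k) z - deriv f z" "\<lambda>k. 2 * a k / K"]) auto
    then have "(\<lambda>k. deriv (g k) z) \<longlonglongrightarrow> deriv f z" by (rule LIM_zero_cancel)
    then have "(\<lambda>k. ennreal (norm (deriv (g k) z))) \<longlonglongrightarrow> ennreal (norm (deriv f z))"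
      by (intro tendsto_ennrealI tendsto_norm)
    then show ?thesis using True by (simp add: H_def)
  qed (simp add: H_def)
  have "(\<integral>\<^sup>+z\<in>ball 0 1. ennreal (norm (deriv f z)) \<partial>lborel) = (\<integral>\<^sup>+z. liminf (\<lambda>k. ennreal (norm (H k z))) \<partial>lborel)"
    by (intro nn_integral_cong) (simp add: lim_imp_Liminf[OF _ lim])
  also have "\<dots> \<le> liminf (\<lambda>k. (\<integral>\<^sup>+z. ennreal (norm (H k z)) \<partial>lborel))"
    by (rule nn_integral_liminf) measurable
  also have "\<dots> \<le> ennreal C"
    by (rule order_trans[OF Liminf_mono[of _ "\<lambda>_. ennreal C"]]) (auto simp: bound' Liminf_const)
  finally show ?thesis by (simp add: order_le_less_trans)
qed

section \<open>Hardy spaces\<close>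

lemma continuous_on_circle:
  assumes "h holomorphic_on ball 0 1" "0 \<le> r" "r < 1"
  shows "continuous_on S (\<lambda>t. h (of_real r * cis t))"
  by (rule continuous_on_compose2[OF holomorphic_on_imp_continuous_on[OF assms(1)]])
     (use assms in \<open>auto simp: norm_mult intro!: continuous_intros\<close>)

lemma continuous_on_circle_powr:
  assumes "h holomorphic_on ball 0 1" "0 \<le> r" "r < 1" "q > 0"
  shows "continuous_on S (\<lambda>t. norm (h (of_real r * cis t)) powr q)"
  using assms by (intro continuous_on_powr' continuous_on_norm continuous_on_circle continuous_on_const) auto

lemma rational_functions_bounded:
  assumes "g \<in> rational_functions n"
  obtains P Q B where "g = (\<lambda>z. poly P z / poly Q z)" "degree P \<le> n" "degree Q \<le> n"
    "\<And>z. norm z \<le> 1 \<Longrightarrow> poly Q z \<noteq> 0" "g holomorphic_on ball 0 1" "\<And>z. norm z < 1 \<Longrightarrow> norm (g z) \<le> B"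
proof -
  from assms obtain P Q where PQ: "g = (\<lambda>z. poly P z / poly Q z)" "degree P \<le> n" "degree Q \<le> n"
    "\<And>z. norm z \<le> 1 \<Longrightarrow> poly Q z \<noteq> 0"
    by (auto simp: rational_functions_def)
  have "continuous_on (cball 0 1) g" unfolding PQ(1) using PQ(4) by (intro continuous_intros) auto
  then have "bounded (g ` cball 0 1)" by (intro compact_imp_bounded compact_continuous_image) auto
  then obtain B where B: "\<And>z. norm z \<le> 1 \<Longrightarrow> norm (g z) \<le> B"
    using bounded_iff[of "g ` cball 0 1"] by (metis imageI mem_cball_0)
  have "g holomorphic_on ball 0 1" unfolding PQ(1) using PQ(4) by (intro holomorphic_intros) auto
  from that[OF PQ this B[OF less_imp_le]] show ?thesis .
qed

lemma rational_functions_mono: "m \<le> n \<Longrightarrow> rational_functions m \<subseteq> rational_functions n"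
  unfolding rational_functions_def by fastforce

lemma rational_functions_nonempty: "rational_functions n \<noteq> {}"
proof -
  have "(\<lambda>z. poly 0 z / poly 1 z) \<in> rational_functions n"
    unfolding rational_functions_def by (rule CollectI, rule exI[of _ 0], rule exI[of _ 1]) auto
  then show ?thesis by blast
qed

context
  fixes p :: ennreal
  assumes p1: "1 < p"
begin

lemma enn2real_gt_1: "p \<noteq> \<infinity> \<Longrightarrow> 1 < enn2real p"
  using p1 by (cases p rule: ennreal_cases) (auto simp: ennreal_less_iff[symmetric] simp flip: ennreal_1)

text \<open>Links the Lebesgue integral of the definition to the gauge integral used in all
  estimates above; they agree by continuity on the circle.\<close>

lemma integral_mean_eq:
  assumes h: "h holomorphic_on ball 0 1" and r: "0 \<le> r" "r < 1" and p: "p \<noteq> \<infinity>"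
  shows "integral_mean p r h = 
    (integral {0..2*pi} (\<lambda>t. norm (h (of_real r * cis t)) powr enn2real p) / (2*pi)) powr (1 / enn2real p)"
proof -
  have "set_integrable lborel {0..2*pi} (\<lambda>t. norm (h (of_real r * cis t)) powr enn2real p)"
    using enn2real_gt_1[OF p] by (intro borel_integrable_atLeastAtMost' continuous_on_circle_powr h r) auto
  from set_borel_integral_eq_integral(2)[OF this] show ?thesis
    using p by (simp add: integral_mean_def)
qed

lemma integral_le_of_integral_mean:
  assumes h: "h holomorphic_on ball 0 1" and r: "0 \<le> r" "r < 1" and p: "p \<noteq> \<infinity>"
    and le: "integral_mean p r h \<le> a"
  shows "integral {0..2*pi} (\<lambda>t. norm (h (of_real r * cis t)) powr enn2real p) \<le> 2 * pi * a powr enn2real p"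
proof -
  define I where "I = integral {0..2*pi} (\<lambda>t. norm (h (of_real r * cis t)) powr enn2real p)"
  note q = enn2real_gt_1[OF p]
  have I0: "I \<ge> 0" unfolding I_def
    using q by (intro integral_nonneg integrable_continuous_interval continuous_on_circle_powr h r) auto
  have "((I / (2*pi)) powr (1 / enn2real p)) powr enn2real p \<le> a powr enn2real p"
    using le q unfolding integral_mean_eq[OF h r p] I_def by (intro powr_mono2) auto
  then have "I / (2*pi) \<le> a powr enn2real p" using q I0 by (simp add: powr_powr)
  then show ?thesis by (simp add: I_def divide_le_eq mult.commute)
qed

lemma integral_mean_le:
  assumes h: "h holomorphic_on ball 0 1" and r: "0 \<le> r" "r < 1" and p: "p \<noteq> \<infinity>"
    and le: "integral {0..2*pi} (\<lambda>t. norm (h (of_real r * cis t)) powr enn2real p) \<le> 2 * pi * A"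
  shows "integral_mean p r h \<le> A powr (1 / enn2real p)"
proof -
  note q = enn2real_gt_1[OF p]
  have "integral {0..2*pi} (\<lambda>t. norm (h (of_real r * cis t)) powr enn2real p) \<ge> 0"
    using q by (intro integral_nonneg integrable_continuous_interval continuous_on_circle_powr h r) auto
  then show ?thesis using le q unfolding integral_mean_eq[OF h r p]
    by (intro powr_mono2) (auto simp: divide_le_eq mult.commute)
qed

text \<open>A real \<open>SUP\<close> dominates its members only over a set bounded above, which
  compactness of the circle provides.\<close>

lemma norm_le_integral_mean_infinity:
  assumes h: "h holomorphic_on ball 0 1" and r: "0 \<le> r" "r < 1" and p: "p = \<infinity>" and t: "t \<in> {0..2*pi}"
  shows "norm (h (of_real r * cis t)) \<le> integral_mean p r h"
proof -
  have "compact ((\<lambda>t. norm (h (of_real r * cis t))) ` {0..2*pi})"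
    by (intro compact_continuous_image continuous_on_norm continuous_on_circle h r) auto
  then have "bdd_above ((\<lambda>t. norm (h (of_real r * cis t))) ` {0..2*pi})"
    by (intro bounded_imp_bdd_above compact_imp_bounded)
  then show ?thesis using p t by (auto simp: integral_mean_def intro!: cSUP_upper)
qed

lemma integral_mean_le_hardy_norm:
  assumes "h \<in> hardy_space p" "0 \<le> r" "r < 1"
  shows "integral_mean p r h \<le> hardy_norm p h"
  unfolding hardy_norm_def using assms by (intro cSUP_upper) (auto simp: hardy_space_def)

lemma hardy_norm_nonneg:
  assumes h: "h \<in> hardy_space p"
  shows "0 \<le> hardy_norm p h"
proof -
  have "0 \<le> integral_mean p 0 h" by (auto simp: integral_mean_def)
  also have "\<dots> \<le> hardy_norm p h" using h by (intro integral_mean_le_hardy_norm) auto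
  finally show ?thesis .
qed

text \<open>\<open>hardy_norm\<close> and \<open>rational_approx\<close> are a real supremum and
  infimum, so each \<open>f - g\<close> must first be known to lie in the space. Only membership is
  at stake, and a crude constant will do.\<close>

lemma hardy_space_diff_bounded:
  assumes f: "f \<in> hardy_space p" and g: "g holomorphic_on ball 0 1"
    and B: "\<And>z. norm z < 1 \<Longrightarrow> norm (g z) \<le> B"
  shows "(\<lambda>z. f z - g z) \<in> hardy_space p"
proof -
  have hf: "f holomorphic_on ball 0 1" using f by (simp add: hardy_space_def)
  have hd: "(\<lambda>z. f z - g z) holomorphic_on ball 0 1" by (intro holomorphic_intros hf g)
  have gB: "norm (g (of_real r * cis t)) \<le> B" if "0 \<le> r" "r < 1" for r t
    using that by (intro B) (simp add: norm_mult)
  define K where "K = hardy_norm p f"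
  have K: "integral_mean p r f \<le> K" if "0 \<le> r" "r < 1" for r
    unfolding K_def using that by (rule integral_mean_le_hardy_norm[OF f])
  have "\<exists>A. \<forall>r\<in>{0..<1}. integral_mean p r (\<lambda>z. f z - g z) \<le> A"
  proof (cases "p = \<infinity>")
    case True
    have "integral_mean p r (\<lambda>z. f z - g z) \<le> K + B" if r: "0 \<le> r" "r < 1" for r
    proof -
      have "norm (f (of_real r * cis t) - g (of_real r * cis t)) \<le> K + B" if t: "t \<in> {0..2*pi}" for t
        using norm_triangle_ineq4[of "f (of_real r * cis t)" "g (of_real r * cis t)"] gB[OF r, of t]
          norm_le_integral_mean_infinity[OF hf r True t] K[OF r] by linarith
      then have "(SUP t\<in>{0..2*pi}. norm (f (of_real r * cis t) - g (of_real r * cis t))) \<le> K + B"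
        by (intro cSUP_least) auto
      then show ?thesis using True by (simp add: integral_mean_def)
    qed
    then show ?thesis by (intro exI[of _ "K + B"]) auto
  next
    case False
    define q where "q = enn2real p"
    have q: "q > 1" using enn2real_gt_1[OF False] by (simp add: q_def)
    have "integral_mean p r (\<lambda>z. f z - g z) \<le> (2 powr q * (K powr q + B powr q)) powr (1 / q)" if r: "0 \<le> r" "r < 1" for r
    proof (rule integral_mean_le[OF hd r False, folded q_def])
      have int: "((\<lambda>t. 2 powr q * (norm (f (of_real r * cis t)) powr q + B powr q)) has_integral
         2 powr q * (integral {0..2*pi} (\<lambda>t. norm (f (of_real r * cis t)) powr q) + 2 * pi * B powr q)) {0..2*pi}"
        using has_integral_const_real[of "B powr q" 0 "2*pi"] q
        by (intro has_integral_mult_right has_integral_add integrable_integral integrable_continuous_interval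
             continuous_on_circle_powr hf r) auto
      have "integral {0..2*pi} (\<lambda>t. norm (f (of_real r * cis t) - g (of_real r * cis t)) powr q) \<le>
         integral {0..2*pi} (\<lambda>t. 2 powr q * (norm (f (of_real r * cis t)) powr q + B powr q))"
      proof (rule integral_le)
        show "(\<lambda>t. norm (f (of_real r * cis t) - g (of_real r * cis t)) powr q) integrable_on {0..2*pi}"
          using q by (intro integrable_continuous_interval continuous_on_circle_powr[OF hd r]) auto
        show "(\<lambda>t. 2 powr q * (norm (f (of_real r * cis t)) powr q + B powr q)) integrable_on {0..2*pi}"
          using int by blast
        fix t
        have "norm (g (of_real r * cis t)) powr q \<le> B powr q" using gB[OF r] q by (intro powr_mono2) auto
        then show "norm (f (of_real r * cis t) - g (of_real r * cis t)) powr q \<le> 2 powr q * (norm (f (of_real r * cis t)) powr q + B powr q)"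
          by (intro order_trans[OF powr_norm_diff_le[OF q]] mult_left_mono add_left_mono) auto
      qed
      also have "\<dots> = 2 powr q * (integral {0..2*pi} (\<lambda>t. norm (f (of_real r * cis t)) powr q) + 2 * pi * B powr q)"
        by (rule integral_unique[OF int])
      also have "\<dots> \<le> 2 powr q * (2 * pi * K powr q + 2 * pi * B powr q)"
        unfolding q_def by (intro mult_left_mono add_right_mono integral_le_of_integral_mean[OF hf r False] K r) auto
      finally show "integral {0..2*pi} (\<lambda>t. norm (f (of_real r * cis t) - g (of_real r * cis t)) powr q) \<le> 2 * pi * (2 powr q * (K powr q + B powr q))"
        by (simp add: algebra_simps)
    qed
    then show ?thesis by (intro exI[of _ "(2 powr q * (K powr q + B powr q)) powr (1 / q)"]) auto
  qed
  then have "bdd_above ((\<lambda>r. integral_mean p r (\<lambda>z. f z - g z)) ` {0..<1})"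
    by (meson bdd_aboveI2)
  then show ?thesis using hd by (simp add: hardy_space_def)
qed

lemma hardy_space_diff_rational:
  assumes "f \<in> hardy_space p" "g \<in> rational_functions n"
  shows "(\<lambda>z. f z - g z) \<in> hardy_space p"
  by (rule rational_functions_bounded[OF assms(2)]) (rule hardy_space_diff_bounded[OF assms(1)])

lemma bdd_below_rational_approx:
  assumes "f \<in> hardy_space p"
  shows "bdd_below ((\<lambda>g. hardy_norm p (\<lambda>z. f z - g z)) ` rational_functions n)"
  by (intro bdd_belowI2[where m=0] hardy_norm_nonneg hardy_space_diff_rational[OF assms])

lemma rational_approx_nonneg:
  assumes "f \<in> hardy_space p"
  shows "0 \<le> rational_approx n f p"
  unfolding rational_approx_def
  by (intro cINF_greatest rational_functions_nonempty hardy_norm_nonneg hardy_space_diff_rational[OF assms])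

lemma rational_approx_antimono:
  assumes "f \<in> hardy_space p" "m \<le> n"
  shows "rational_approx n f p \<le> rational_approx m f p"
  unfolding rational_approx_def
  by (intro cINF_superset_mono rational_functions_nonempty bdd_below_rational_approx rational_functions_mono assms) auto

text \<open>The infimum need not be attained, hence the strict inequality. For
  \<open>p = \<infinity>\<close> a uniform bound \<open>a\<close> bounds the mean square by a^2, so
  exponent 2 keeps the same \<open>a\<close> and stays above 1.\<close>

lemma rational_approx_obtain:
  assumes f: "f \<in> hardy_space p" and lt: "rational_approx n f p < a"
  obtains P Q :: "complex poly" where "degree P \<le> n" "degree Q \<le> n" "\<And>z. norm z \<le> 1 \<Longrightarrow> poly Q z \<noteq> 0"
    "\<And>r. 0 \<le> r \<Longrightarrow> r < 1 \<Longrightarrow> integral {0..2*pi} (\<lambda>t. norm (f (of_real r * cis t) - poly P (of_real r * cis t) / poly Q (of_real r * cis t)) 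
       powr (if p = \<infinity> then 2 else enn2real p)) \<le> 2 * pi * a powr (if p = \<infinity> then 2 else enn2real p)"
proof -
  obtain g where g: "g \<in> rational_functions n" "hardy_norm p (\<lambda>z. f z - g z) < a"
    using lt bdd_below_rational_approx[OF f] rational_functions_nonempty
    unfolding rational_approx_def by (subst (asm) cINF_less_iff) auto
  from rational_functions_bounded[OF g(1)] obtain P Q where PQ: "g = (\<lambda>z. poly P z / poly Q z)" "degree P \<le> n" "degree Q \<le> n"
    "\<And>z. norm z \<le> 1 \<Longrightarrow> poly Q z \<noteq> 0" by metis
  have d: "(\<lambda>z. f z - g z) \<in> hardy_space p" by (rule hardy_space_diff_rational[OF f g(1)])
  then have hd: "(\<lambda>z. f z - g z) holomorphic_on ball 0 1" by (simp add: hardy_space_def)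
  show ?thesis
  proof (rule that[OF PQ(2-4)])
    fix r :: real assume r: "0 \<le> r" "r < 1"
    have le: "integral_mean p r (\<lambda>z. f z - g z) \<le> a"
      using integral_mean_le_hardy_norm[OF d r] g(2) by simp
    show "integral {0..2*pi} (\<lambda>t. norm (f (of_real r * cis t) - poly P (of_real r * cis t) / poly Q (of_real r * cis t)) 
       powr (if p = \<infinity> then 2 else enn2real p)) \<le> 2 * pi * a powr (if p = \<infinity> then 2 else enn2real p)"
    proof (cases "p = \<infinity>")
      case True
      have "integral {0..2*pi} (\<lambda>t. norm (f (of_real r * cis t) - g (of_real r * cis t)) powr 2) \<le> integral {0..2*pi} (\<lambda>t. a powr 2)"
      proof (rule integral_le)
        show "(\<lambda>t. norm (f (of_real r * cis t) - g (of_real r * cis t)) powr 2) integrable_on {0..2*pi}"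
          by (intro integrable_continuous_interval continuous_on_circle_powr[OF hd r]) simp
        show "(\<lambda>t. a powr 2) integrable_on {0..2*pi}" by (rule integrable_const_ivl)
        fix t assume "t \<in> {0..2*pi}"
        from norm_le_integral_mean_infinity[OF hd r True this] le
        show "norm (f (of_real r * cis t) - g (of_real r * cis t)) powr 2 \<le> a powr 2"
          by (intro powr_mono2) auto
      qed
      then show ?thesis using True by (simp add: PQ(1))
    next
      case False
      then show ?thesis using integral_le_of_integral_mean[OF hd r False le] by (simp add: PQ(1))
    qed
  qed
qed

end

section \<open>Condensation of the series and proof of the theorem\<close>

lemma ln_diff_le_sum_inverse:
  fixes a b :: nat
  assumes "0 < a" "a \<le> b"
  shows "ln (real b) - ln (real a) \<le> (\<Sum>n\<in>{a..<b}. 1 / real n)"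
proof -
  have "ln (real b) - ln (real a) = (\<Sum>n\<in>{a..<b}. ln (real (Suc n)) - ln (real n))"
    by (rule sum_Suc_diff'[symmetric]) fact
  also have "\<dots> \<le> (\<Sum>n\<in>{a..<b}. 1 / real n)"
  proof (rule sum_mono)
    fix n assume "n \<in> {a..<b}"
    then have n: "real n > 0" using assms by auto
    have "ln (real (Suc n)) - ln (real n) = ln (1 + 1 / real n)"
    proof -
      have "ln (real (Suc n)) - ln (real n) = ln (real (Suc n) / real n)"
        using n by (subst ln_div) auto
      also have "real (Suc n) / real n = 1 + 1 / real n" using n by (simp add: field_simps)
      finally show ?thesis .
    qed
    also have "\<dots> \<le> 1 / real n" using n by (intro ln_add_one_self_le_self) auto
    finally show "ln (real (Suc n)) - ln (real n) \<le> 1 / real n" .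
  qed
  finally show ?thesis .
qed

text \<open>The blocks are doubly exponential so that the logarithm is comparable at both ends of a block.\<close>
lemma summable_doubly_exponential_condensation:
  fixes R :: "nat \<Rightarrow> real"
  assumes nn: "\<And>n. R n \<ge> 0" and dec: "\<And>m n. m \<le> n \<Longrightarrow> R n \<le> R m"
    and sm: "(\<lambda>n. R n / (real n * sqrt (ln (real n)))) summable_on {2..}"
  shows "summable (\<lambda>k. sqrt (ln (real ((2::nat) ^ 2 ^ k))) * R (2 ^ 2 ^ Suc k))"
proof -
  define F where "F n = R n / (real n * sqrt (ln (real n)))" for n
  define nk :: "nat \<Rightarrow> nat" where "nk k = 2 ^ 2 ^ k" for k
  define c where "c k = sqrt (ln (real (nk k))) * R (nk (Suc k))" for k
  have nk2: "2 \<le> nk k" for k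
    using power_increasing[of 1 "2 ^ k" "2::nat"] by (simp add: nk_def)
  have nkS: "nk (Suc k) = (nk k)\<^sup>2" for k by (simp add: nk_def power_mult[symmetric] mult.commute)
  have nkm: "nk k \<le> nk (Suc k)" for k using nk2[of k] by (simp add: nkS power2_eq_square)
  have lnS: "ln (real (nk (Suc k))) = 2 * ln (real (nk k))" for k
    using nk2[of k] by (simp add: nkS ln_realpow)
  have F0: "F n \<ge> 0" if "n \<ge> 2" for n using that nn by (auto simp: F_def intro!: divide_nonneg_nonneg)
  \<comment> \<open>Over the block the sum of 1/n is at least ln (nk (Suc k)) - ln (nk k) = L, while
    R n is at least its value at the right end and sqrt (ln n) at most sqrt (2 L). This gives R L /
    sqrt (2 L), and explains why \<open>c k\<close> pairs the logarithm at \<open>nk k\<close> with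
    \<open>R\<close> at \<open>nk (Suc k)\<close>.\<close>
  have block: "c k / sqrt 2 \<le> sum F {nk k..<nk (Suc k)}" for k
  proof -
    define L where "L = ln (real (nk k))"
    have L: "L > 0" using nk2[of k] by (simp add: L_def)
    have "c k / sqrt 2 = R (nk (Suc k)) / sqrt (2 * L) * L"
    proof -
      have "sqrt L * sqrt L = L" using L by simp
      then show ?thesis using L by (simp add: c_def L_def[symmetric] real_sqrt_mult field_simps)
    qed
    also have "\<dots> = R (nk (Suc k)) / sqrt (2 * L) * (ln (real (nk (Suc k))) - ln (real (nk k)))"
      by (simp add: lnS L_def)
    also have "\<dots> \<le> R (nk (Suc k)) / sqrt (2 * L) * (\<Sum>n\<in>{nk k..<nk (Suc k)}. 1 / real n)"
      using nk2[of k] nkm nn L by (intro mult_left_mono ln_diff_le_sum_inverse divide_nonneg_nonneg) auto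
    also have "\<dots> = (\<Sum>n\<in>{nk k..<nk (Suc k)}. R (nk (Suc k)) / (real n * sqrt (2 * L)))"
      by (simp add: sum_distrib_left mult.commute)
    also have "\<dots> \<le> sum F {nk k..<nk (Suc k)}"
    proof (rule sum_mono)
      fix n assume n: "n \<in> {nk k..<nk (Suc k)}"
      then have n2: "n \<ge> 2" using nk2[of k] by auto
      have "ln (real n) \<le> ln (real (nk (Suc k)))" using n n2 by (subst ln_le_cancel_iff) auto
      then have "sqrt (ln (real n)) \<le> sqrt (2 * L)" by (simp add: lnS L_def)
      moreover have "0 < sqrt (ln (real n))" using n2 by simp
      ultimately show "R (nk (Suc k)) / (real n * sqrt (2 * L)) \<le> F n"
        unfolding F_def using n n2 nn dec[of n "nk (Suc k)"] by (intro frac_le mult_left_mono mult_pos_pos) auto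
    qed
    finally show ?thesis .
  qed
  have partial: "(\<Sum>k<K. c k / sqrt 2) \<le> sum F {2..<nk K}" for K
  proof (induction K)
    case 0
    show ?case by (simp add: nk_def)
  next
    case (Suc K)
    have "(\<Sum>k<Suc K. c k / sqrt 2) \<le> sum F {2..<nk K} + sum F {nk K..<nk (Suc K)}"
      using Suc block[of K] by simp
    also have "\<dots> = sum F {2..<nk (Suc K)}" by (rule sum.atLeastLessThan_concat) (use nk2 nkm in auto)
    finally show ?case .
  qed
  have "(\<Sum>k<K. c k) \<le> sqrt 2 * infsum F {2..}" for K
  proof -
    have "sum F {2..<nk K} \<le> infsum F {2..}"
      using sm by (intro finite_sum_le_infsum) (auto simp: F_def[abs_def] intro!: F0[unfolded F_def])
    with partial[of K] have "(\<Sum>k<K. c k) / sqrt 2 \<le> infsum F {2..}" by (simp add: sum_divide_distrib)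
    then show ?thesis by (simp add: divide_le_eq mult.commute)
  qed
  moreover have "c k \<ge> 0" for k using nn nk2[of k] by (simp add: c_def)
  ultimately have "summable c" by (intro summableI_nonneg_bounded)
  then show ?thesis by (simp add: c_def[abs_def] nk_def)
qed

theorem theorem1p6:
  fixes p :: ennreal and f :: "complex \<Rightarrow> complex"
  assumes "1 < p"
    and "f \<in> hardy_space p"
    and "(\<lambda>n. rational_approx n f p / (real n * sqrt (ln (real n)))) summable_on {2::nat..}"
  shows "deriv f \<in> bergman_space_1"
proof -
  have hol: "f holomorphic_on ball 0 1" using assms(2) by (simp add: hardy_space_def)
  define R where "R n = rational_approx n f p" for n
  have R0: "R n \<ge> 0" for n unfolding R_def by (rule rational_approx_nonneg[OF assms(1,2)])
  have Rdec: "R n \<le> R m" if "m \<le> n" for m n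
    unfolding R_def by (rule rational_approx_antimono[OF assms(1,2) that])
  \<comment> \<open>The shift \<open>Suc k\<close> matches the right end of a block in the
    condensation; in the square root of the logarithm it costs a constant factor only.\<close>
  define M :: "nat \<Rightarrow> nat" where "M k = 2 ^ 2 ^ Suc k" for k
  have M_mono: "M k \<le> M l" if "k \<le> l" for k l unfolding M_def using that by (intro power_increasing) auto
  have M1: "M k \<ge> 1" for k by (simp add: M_def)
  \<comment> \<open>The added term makes \<open>a k\<close> positive and strictly larger than the
    infimum, so near-best approximants exist. It is harmless in the series since
    \<open>w k \<le> 2 ^ k\<close>.\<close>
  define a where "a k = R (M k) + (1/4) ^ k" for k
  have a: "a k > 0" "a (Suc k) \<le> a k" for k
    using R0[of "M k"] Rdec[OF M_mono[of k "Suc k"]] by (auto simp: a_def intro!: add_nonneg_pos add_mono)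
  define q where "q = (if p = \<infinity> then 2 else enn2real p)"
  have q: "q > 1" using enn2real_gt_1[OF assms(1)] by (simp add: q_def)
  define good where "good k P Q \<longleftrightarrow> degree P \<le> M k \<and> degree Q \<le> M k \<and> (\<forall>z. norm z \<le> 1 \<longrightarrow> poly Q z \<noteq> 0) \<and>
    (\<forall>r. 0 \<le> r \<longrightarrow> r < 1 \<longrightarrow> integral {0..2*pi} (\<lambda>t. norm (f (of_real r * cis t) - poly P (of_real r * cis t) / poly Q (of_real r * cis t)) 
       powr q) \<le> 2 * pi * a k powr q)" for k and P Q :: "complex poly"
  have "\<exists>P Q. good k P Q" for k
  proof -
    have "rational_approx (M k) f p < a k" by (simp add: a_def R_def)
    then show ?thesis unfolding good_def
      by (rule rational_approx_obtain[OF assms(1,2), folded q_def]) (intro exI conjI allI impI)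
  qed
  then obtain P Q where "\<And>k. good k (P k) (Q k)" by metis
  then have PQ: "\<And>k. degree (P k) \<le> M k" "\<And>k. degree (Q k) \<le> M k" 
     "\<And>k z. norm z \<le> 1 \<Longrightarrow> poly (Q k) z \<noteq> 0"
     "\<And>k r. 0 \<le> r \<Longrightarrow> r < 1 \<Longrightarrow> integral {0..2*pi} (\<lambda>t. norm (f (of_real r * cis t) - poly (P k) (of_real r * cis t) / poly (Q k) (of_real r * cis t)) 
       powr q) \<le> 2 * pi * a k powr q"
    unfolding good_def by blast+
  define w where "w k = sqrt (ln (real ((2::nat) ^ 2 ^ k)))" for k :: nat
  have w: "w k = sqrt (2 ^ k * ln 2)" for k by (simp add: w_def ln_realpow)
  have w0: "w k \<ge> 0" for k by (simp add: w)
  have w2: "w k \<le> 2 ^ k" for k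
  proof -
    have "2 ^ k * ln 2 \<le> (2::real) ^ k * 2 ^ k"
      using ln_2_less_1 one_le_power[of "2::real" k] by (intro mult_left_mono) linarith+
    then have "w k \<le> sqrt ((2 ^ k)\<^sup>2)" unfolding w power2_eq_square by (rule real_sqrt_le_mono)
    then show ?thesis by simp
  qed
  have "summable (\<lambda>k. w k * R (M k))"
    unfolding w_def M_def R_def
    by (rule summable_doubly_exponential_condensation) (use R0 Rdec assms(3) in \<open>auto simp: R_def\<close>)
  moreover have "summable (\<lambda>k. w k * (1/4) ^ k)"
  proof (rule summable_comparison_test')
    show "summable (\<lambda>k. (1/2::real) ^ k)" by (rule summable_geometric) simp
    show "norm (w k * (1/4) ^ k) \<le> (1/2) ^ k" for k
    proof -
      have "w k * (1/4) ^ k \<le> 2 ^ k * (1/4) ^ k" by (intro mult_right_mono w2) simp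
      also have "\<dots> = (1/2) ^ k" by (simp add: power_mult_distrib[symmetric])
      finally show ?thesis using w0[of k] by simp
    qed
  qed
  ultimately have "summable (\<lambda>k. w k * a k)"
    unfolding a_def distrib_left by (rule summable_add)
  then have sm3: "summable (\<lambda>k. 3 * (w k * a k))" by (rule summable_mult)
  \<comment> \<open>M k + M (Suc k) is at most the square of M (Suc k), which is 2^(8 * 2^k); its
    logarithm is 8 times the square of \<open>w k\<close>. The 8 is raised to 9 to have an exact
    root.\<close>
  have sm: "summable (\<lambda>k. sqrt (ln (real (M k + M (Suc k)))) * a k)"
  proof (rule summable_comparison_test'[OF sm3])
    fix k
    have "M k + M (Suc k) \<le> 2 * M (Suc k)" using M_mono[of k "Suc k"] by simp
    also have "\<dots> \<le> M (Suc k) * M (Suc k)"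
      using power_increasing[of 1 "2 ^ Suc (Suc k)" "2::nat"] by (intro mult_right_mono) (auto simp: M_def)
    also have "\<dots> = 2 ^ (8 * 2 ^ k)" by (simp add: M_def power_add[symmetric])
    finally have le: "M k + M (Suc k) \<le> 2 ^ (8 * 2 ^ k)" .
    have "ln (real (M k + M (Suc k))) \<le> ln (real (2 ^ (8 * 2 ^ k)))"
      using le M1[of k] by (subst ln_le_cancel_iff) (auto simp del: of_nat_add of_nat_power)
    also have "\<dots> = 8 * (2 ^ k * ln 2)" by (simp add: ln_realpow)
    also have "\<dots> \<le> 9 * (2 ^ k * ln 2)" by simp
    finally have "sqrt (ln (real (M k + M (Suc k)))) \<le> sqrt 9 * w k"
      unfolding w by (simp only: real_sqrt_mult[symmetric] real_sqrt_le_mono)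
    moreover have "sqrt 9 = (3::real)" using real_sqrt_abs[of 3] by simp
    moreover have "0 \<le> ln (real (M k + M (Suc k)))" using M1[of k] by simp
    ultimately show "norm (sqrt (ln (real (M k + M (Suc k)))) * a k) \<le> 3 * (w k * a k)"
      using a(1)[of k] by (simp add: mult_right_mono abs_mult)
  qed
  have fin: "(\<integral>\<^sup>+z\<in>ball 0 1. ennreal (norm (deriv f z)) \<partial>lborel) < \<infinity>"
    by (rule bergman_of_rational_approx[OF hol q a PQ(3) PQ(1,2) M1 PQ(4) sm])
  have dhol: "deriv f holomorphic_on ball 0 1" using hol by (rule holomorphic_deriv) simp
  have "set_integrable lborel (ball 0 1) (deriv f)"
    unfolding set_integrable_def
  proof (rule integrableI_bounded)
    show "(\<lambda>z. indicator (ball 0 1) z *\<^sub>R deriv f z) \<in> borel_measurable lborel"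
      using borel_measurable_on_disc[OF dhol] by simp
    have "(\<integral>\<^sup>+z. ennreal (norm (indicator (ball 0 1) z *\<^sub>R deriv f z)) \<partial>lborel) = (\<integral>\<^sup>+z\<in>ball 0 1. ennreal (norm (deriv f z)) \<partial>lborel)"
      by (intro nn_integral_cong) (auto simp: indicator_def)
    with fin show "(\<integral>\<^sup>+z. ennreal (norm (indicator (ball 0 1) z *\<^sub>R deriv f z)) \<partial>lborel) < \<infinity>" by simp
  qed
  with dhol show ?thesis by (simp add: bergman_space_1_def)
qed

end
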